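(* Consider the generalized incremental knapsack problem (defined in the context). For any accuracy level $\epsilon \in (0,\tfrac{1}{2})$, there is an algorithm that, on every instance, computes a feasible chain whose profit is at least $(\tfrac{1}{2}-\epsilon)$ times the maximum profit of a feasible chain. Its running time is $O(n^{O(1/\epsilon^2)} \cdot |\mathcal{I}|^{O(1)})$, where $|\mathcal{I}| = \Theta(n\log \|w\|_{\infty} + nT\log \|p\|_{\infty} + T\log \|W\|_{\infty})$ denotes the input size.
   Context: Generalized incremental knapsack: we are given $n$ items with strictly positive weights $w_1,\dots,w_n$, $T$ time periods with non-decreasing capacities $W_1 \le \cdots \le W_T$, and non-negative profits $p_{it}$ for $i\in[n]$, $t\in[T]$. A chain is a sequence $\mathcal{S}=(S_1,\dots,S_T)$ with $S_1\subseteq\cdots\subseteq S_T\subseteq[n]$; it is feasible if $w(S_t)=\sum_{i\in S_t}w_i\le W_t$ for every $t\in[T]$. Its profit is $\Phi(\mathcal{S})=\sum_{t\in[T]}\sum_{i\in S_t\setminus S_{t-1}}p_{it}$, with $S_0=\emptyset$ (i.e., item $i$ earns $p_{it}$ if it is inserted at time $t$). The goal is to find a feasible chain of maximum profit. *)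

theory Defs
  imports "HOL-Library.Log_Nat"
begin

section \<open>Generalized incremental knapsack\<close>

text \<open>
  Instance data are integral, as presupposed by an input size measured in logarithms of the
  data. Items are \<open>1, \<dots>, n_items I\<close> and periods are \<open>1, \<dots>, horizon I\<close>; values of the
  data functions outside these ranges are irrelevant.
\<close>

record gik =
  n_items :: nat
  horizon :: nat
  weight :: "nat \<Rightarrow> nat"
  capacity :: "nat \<Rightarrow> nat"
  profit :: "nat \<Rightarrow> nat \<Rightarrow> nat"

definition items :: "gik \<Rightarrow> nat set" where
  "items I = {1..n_items I}"

definition periods :: "gik \<Rightarrow> nat set" where
  "periods I = {1..horizon I}"

definition gik_instance :: "gik \<Rightarrow> bool" where
  "gik_instance I \<longleftrightarrow>
     1 \<le> n_items I \<and> 1 \<le> horizon I \<and>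
     (\<forall>i\<in>items I. 0 < weight I i) \<and>
     (\<forall>s\<in>periods I. \<forall>t\<in>periods I. s \<le> t \<longrightarrow> capacity I s \<le> capacity I t)"

definition is_chain :: "gik \<Rightarrow> (nat \<Rightarrow> nat set) \<Rightarrow> bool" where
  "is_chain I S \<longleftrightarrow>
     S 0 = {} \<and> (\<forall>t\<in>periods I. S (t - 1) \<subseteq> S t) \<and> S (horizon I) \<subseteq> items I"

definition feasible_chain :: "gik \<Rightarrow> (nat \<Rightarrow> nat set) \<Rightarrow> bool" where
  "feasible_chain I S \<longleftrightarrow>
     is_chain I S \<and> (\<forall>t\<in>periods I. (\<Sum>i\<in>S t. weight I i) \<le> capacity I t)"

definition chain_profit :: "gik \<Rightarrow> (nat \<Rightarrow> nat set) \<Rightarrow> nat" where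
  "chain_profit I S = (\<Sum>t\<in>periods I. \<Sum>i\<in>S t - S (t - 1). profit I i t)"

definition max_profit :: "gik \<Rightarrow> nat" where
  "max_profit I = Max {chain_profit I S | S. feasible_chain I S}"

lemma chain_subset_items:
  assumes "is_chain I S" "t \<le> horizon I"
  shows "S t \<subseteq> items I"
  using assms(2)
proof (induction t rule: inc_induct)
  case base
  show ?case using assms(1) by (simp add: is_chain_def)
next
  case (step t)
  have "S (Suc t - 1) \<subseteq> S (Suc t)"
    using assms(1) step.hyps unfolding is_chain_def periods_def
    by (metis Suc_leI atLeastAtMost_iff le_add1 plus_1_eq_Suc)
  with step.IH show ?case by auto
qed

lemma finite_feasible_profits: "finite {chain_profit I S | S. feasible_chain I S}"
proof -
  let ?B = "\<Sum>t\<in>periods I. \<Sum>i\<in>items I. profit I i t"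
  have "chain_profit I S \<le> ?B" if "feasible_chain I S" for S
    unfolding chain_profit_def
  proof (intro sum_mono sum_mono2)
    fix t assume "t \<in> periods I"
    then have "S t \<subseteq> items I"
      using chain_subset_items that by (auto simp: feasible_chain_def periods_def)
    then show "S t - S (t - 1) \<subseteq> items I" by blast
  qed (auto simp: items_def)
  then have "{chain_profit I S | S. feasible_chain I S} \<subseteq> {..?B}" by auto
  then show ?thesis by (rule finite_subset) simp
qed

lemma feasible_chain_empty: "feasible_chain I (\<lambda>_. {})"
  by (simp add: feasible_chain_def is_chain_def)

lemma max_profit_attained: "\<exists>S. feasible_chain I S \<and> chain_profit I S = max_profit I"
proof -
  have "max_profit I \<in> {chain_profit I S | S. feasible_chain I S}"
    unfolding max_profit_def
    using finite_feasible_profits feasible_chain_empty by (intro Max_in) auto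
  then show ?thesis by auto
qed

lemma max_profit_upper: "feasible_chain I S \<Longrightarrow> chain_profit I S \<le> max_profit I"
  unfolding max_profit_def by (intro Max_ge finite_feasible_profits) auto

text \<open>
  Length of the binary representation; at least 1, so that the number 0 and instances all of
  whose data are 0 or 1 do not have size 0.
\<close>

definition bits :: "nat \<Rightarrow> nat" where
  "bits k = max 1 (floorlog 2 k)"

definition input_size :: "gik \<Rightarrow> nat" where
  "input_size I =
     n_items I * bits (Max (weight I ` items I)) +
     n_items I * horizon I * bits (Max ((\<lambda>(i, t). profit I i t) ` (items I \<times> periods I))) +
     horizon I * bits (Max (capacity I ` periods I))"


section \<open>Model of computation\<close>

text \<open>
  A random access machine with logarithmic cost, presented as a structured while-language.
  Memory consists of named arrays of unbounded natural numbers, and a scalar is cell 0 of an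
  array. A program mentions only finitely many names. Every operation is charged the number
  of bits of its operands, including addresses, so that big-number arithmetic and indirect
  addressing are not free. Subtraction is truncated and division by 0 yields 0.
\<close>

type_synonym memory = "string \<Rightarrow> nat \<Rightarrow> nat"

datatype binop = Add | Sub | Mul | Div

datatype exp =
    Const nat
  | Read string exp
  | Bin binop exp exp

datatype com =
    Skip
  | Write string exp exp
  | Seq com com
  | If exp com com
  | While exp com

fun apply_op :: "binop \<Rightarrow> nat \<Rightarrow> nat \<Rightarrow> nat" where
  "apply_op Add a b = a + b"
| "apply_op Sub a b = a - b"
| "apply_op Mul a b = a * b"
| "apply_op Div a b = a div b"

fun val :: "exp \<Rightarrow> memory \<Rightarrow> nat" where
  "val (Const k) m = k"
| "val (Read x e) m = m x (val e m)"
| "val (Bin f a b) m = apply_op f (val a m) (val b m)"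

fun cost :: "exp \<Rightarrow> memory \<Rightarrow> nat" where
  "cost (Const k) m = bits k"
| "cost (Read x e) m = cost e m + bits (val e m) + bits (m x (val e m))"
| "cost (Bin f a b) m = cost a m + cost b m + bits (val a m) + bits (val b m)"

text \<open>
  \<open>run c m k m'\<close>: started in memory \<open>m\<close>, program \<open>c\<close> halts after time \<open>k\<close> in memory \<open>m'\<close>.
  Tests succeed on nonzero values.
\<close>

inductive run :: "com \<Rightarrow> memory \<Rightarrow> nat \<Rightarrow> memory \<Rightarrow> bool" where
  run_Skip: "run Skip m 1 m"
| run_Write:
    "run (Write x a e) m
       (cost a m + cost e m + bits (val a m) + bits (val e m))
       (m(x := (m x)(val a m := val e m)))"
| run_Seq: "run c m k m' \<Longrightarrow> run d m' l m'' \<Longrightarrow> run (Seq c d) m (k + l) m''"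
| run_If_True:
    "val b m \<noteq> 0 \<Longrightarrow> run c m k m' \<Longrightarrow> run (If b c d) m (cost b m + bits (val b m) + k) m'"
| run_If_False:
    "val b m = 0 \<Longrightarrow> run d m k m' \<Longrightarrow> run (If b c d) m (cost b m + bits (val b m) + k) m'"
| run_While_False:
    "val b m = 0 \<Longrightarrow> run (While b c) m (cost b m + bits (val b m)) m"
| run_While_True:
    "val b m \<noteq> 0 \<Longrightarrow> run c m k m' \<Longrightarrow> run (While b c) m' l m'' \<Longrightarrow>
       run (While b c) m (cost b m + bits (val b m) + k + l) m''"

inductive_cases run_SkipE: "run Skip m k m'"
inductive_cases run_WriteE: "run (Write x a e) m k m'"
inductive_cases run_SeqE: "run (Seq c d) m k m'"
inductive_cases run_IfE: "run (If b c d) m k m'"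
inductive_cases run_WhileE: "run (While b c) m k m'"

lemma run_deterministic:
  "run c m k m' \<Longrightarrow> run c m l m'' \<Longrightarrow> k = l \<and> m' = m''"
proof (induction arbitrary: l m'' rule: run.induct)
  case run_Skip
  then show ?case by (auto elim: run_SkipE)
next
  case run_Write
  then show ?case by (auto elim: run_WriteE)
next
  case (run_Seq c m k m' d k' m2)
  from run_Seq.prems obtain k1 m1 k2 where
    "l = k1 + k2" and c: "run c m k1 m1" and d: "run d m1 k2 m''" by (rule run_SeqE)
  moreover from c have "k = k1 \<and> m' = m1" by (rule run_Seq.IH(1))
  moreover from this d have "k' = k2 \<and> m2 = m''" by (intro run_Seq.IH(2)) simp
  ultimately show ?case by simp
next
  case (run_If_True b m c k m' d)
  from run_If_True.prems run_If_True.hyps(1) obtain k1 where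
    "l = cost b m + bits (val b m) + k1" and c: "run c m k1 m''" by (auto elim: run_IfE)
  moreover from c have "k = k1 \<and> m' = m''" by (rule run_If_True.IH)
  ultimately show ?case by simp
next
  case (run_If_False b m d k m' c)
  from run_If_False.prems run_If_False.hyps(1) obtain k1 where
    "l = cost b m + bits (val b m) + k1" and c: "run d m k1 m''" by (auto elim: run_IfE)
  moreover from c have "k = k1 \<and> m' = m''" by (rule run_If_False.IH)
  ultimately show ?case by simp
next
  case run_While_False
  from run_While_False.prems run_While_False.hyps show ?case by (auto elim: run_WhileE)
next
  case (run_While_True b m c k m' k' m2)
  from run_While_True.prems run_While_True.hyps(1) obtain k1 m1 k2 where
    "l = cost b m + bits (val b m) + k1 + k2" and c: "run c m k1 m1"
    and w: "run (While b c) m1 k2 m''" by (auto elim: run_WhileE)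
  moreover from c have "k = k1 \<and> m' = m1" by (rule run_While_True.IH(1))
  moreover from this w have "k' = k2 \<and> m2 = m''" by (intro run_While_True.IH(2)) simp
  ultimately show ?case by simp
qed

text \<open>
  Matrices indexed by items and periods are stored row by row, entry \<open>(i, t)\<close> in cell
  \<open>i * (horizon I + 1) + t\<close>. Cells outside the index ranges are 0 initially, so that memory
  carries no information beyond the instance.
\<close>

definition entry :: "gik \<Rightarrow> nat \<Rightarrow> nat \<Rightarrow> nat" where
  "entry I i t = i * (horizon I + 1) + t"

definition input_memory :: "gik \<Rightarrow> memory" where
  "input_memory I = (\<lambda>_ _. 0)
     (''n'' := (\<lambda>_. 0)(0 := n_items I),
      ''T'' := (\<lambda>_. 0)(0 := horizon I),
      ''w'' := (\<lambda>i. if i \<in> items I then weight I i else 0),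
      ''W'' := (\<lambda>t. if t \<in> periods I then capacity I t else 0),
      ''p'' := (\<lambda>j. let i = j div (horizon I + 1); t = j mod (horizon I + 1)
                in if i \<in> items I \<and> t \<in> periods I then profit I i t else 0))"

lemma input_memory_profit:
  "i \<in> items I \<Longrightarrow> t \<in> periods I \<Longrightarrow> input_memory I ''p'' (entry I i t) = profit I i t"
proof -
  assume "i \<in> items I" "t \<in> periods I"
  moreover from this have "entry I i t div (horizon I + 1) = i" "entry I i t mod (horizon I + 1) = t"
    unfolding entry_def periods_def
    by (auto simp only: div_mult_self3 mod_mult_self3 atLeastAtMost_iff div_less mod_less)
  ultimately show ?thesis by (simp add: input_memory_def Let_def)
qed

text \<open>The output is the membership matrix of the chain, in array \<open>S\<close>.\<close>

definition output_chain :: "gik \<Rightarrow> memory \<Rightarrow> nat \<Rightarrow> nat set" where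
  "output_chain I m t =
     (if t \<in> periods I then {i \<in> items I. m ''S'' (entry I i t) \<noteq> 0} else {})"

end

theory Submission
  imports Defs
begin

text \<open>
  Inserting item \<open>i\<close> at time \<open>t\<close> is viewed as scheduling an interval \<open>(e - w\<^sub>i, e]\<close> with
  \<open>e \<le> W\<^sub>t\<close> and profit \<open>p\<^sub>i\<^sub>t\<close>; feasible chains correspond to families of disjoint intervals
  with one interval per item. For this problem the two-phase local ratio method applies. Intervals are
  pushed on a stack in the order of their right ends, each with the value that remains of its
  profit after subtracting the values of all stacked intervals in conflict with it (same item, or
  overlapping), provided that this value is positive and at least a fraction \<open>1 / q\<close> of the
  profit. Popping the stack greedily then yields a chain whose profit is at least the total value on
  the stack. Every stacked interval is in conflict with at most two later intervals of an optimal
  solution, one of the same item and one containing its right end, so that the total value is at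
  least \<open>(1 - 1 / q) / 2\<close> times the optimum. The threshold \<open>1 / q\<close> bounds the height of the
  stack by \<open>1 + n T q\<close>, so the running time is polynomial in the input size and
  in \<open>q\<close>, which is of order \<open>1 / \<epsilon>\<close>. If \<open>n = 1\<close>, no power of \<open>n\<close> can absorb a
  dependence on \<open>\<epsilon>\<close>; but then no overlaps with other items occur, and \<open>q = 2\<close> suffices.
\<close>

section \<open>Stacks of intervals\<close>

definition good :: "nat \<Rightarrow> nat \<Rightarrow> nat \<Rightarrow> bool" where
  "good q p s \<longleftrightarrow> s < p \<and> p \<le> q * (p - s)"

text \<open>What a rejection is worth: the values in conflict with the interval already pay for its
  profit up to the factor \<open>q / (q - 1)\<close>.\<close>

lemma not_goodD:
  assumes "\<not> good q p s"
  shows "(q - 1) * p \<le> q * s"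
proof (cases "p \<le> s")
  case True
  then show ?thesis by (intro mult_mono) auto
next
  case False
  with assms have "q * (p - s) < p" by (auto simp: good_def)
  moreover have "q * p = q * (p - s) + q * s"
    using False by (metis add_mult_distrib2 le_add_diff_inverse2 nat_le_linear)
  ultimately show ?thesis by (simp add: diff_mult_distrib)
qed

text \<open>Meant for ends \<open>e\<close> that lie at or after all \<open>En j\<close> with
  \<open>j \<le> l\<close>: such an interval \<open>(e - w, e]\<close> overlaps the
  \<open>j\<close>-th one exactly when its left end lies before \<open>En j\<close>. The weight
  stands on the right-hand side because subtraction is truncated.\<close>

definition conf ::
  "gik \<Rightarrow> (nat \<Rightarrow> nat) \<Rightarrow> (nat \<Rightarrow> nat) \<Rightarrow> (nat \<Rightarrow> nat) \<Rightarrow> nat \<Rightarrow> nat \<Rightarrow> nat \<Rightarrow> nat" where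
  "conf I It En Va l i e = sum Va {j \<in> {1..l}. It j = i \<or> e < En j + weight I i}"

lemma conf_cong:
  assumes "\<And>j. j \<in> {1..l} \<Longrightarrow> It' j = It j" "\<And>j. j \<in> {1..l} \<Longrightarrow> En' j = En j"
    "\<And>j. j \<in> {1..l} \<Longrightarrow> Va' j = Va j"
  shows "conf I It' En' Va' l i e = conf I It En Va l i e"
  unfolding conf_def using assms by (intro sum.cong) auto

text \<open>Entry 1 is a dummy of value 0 whose end 0 lets an item start at the origin.
  \<open>covered\<close> is the memory of the sweep: an interval ending before the top was rejected
  against some prefix of the stack, namely the part present when the sweep passed its end. The
  entries of that prefix end at or before \<open>e\<close>, as the reading of \<open>conf\<close> as
  a conflict sum requires.\<close>

locale gik_stack =
  fixes I :: gik and q L :: nat and It Pt En Va :: "nat \<Rightarrow> nat"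
  assumes inst: "gik_instance I"
    and L_pos: "1 \<le> L"
    and bottom: "It 1 = 0" "En 1 = 0" "Va 1 = 0"
    and En_mono: "1 \<le> j \<Longrightarrow> j \<le> k \<Longrightarrow> k \<le> L \<Longrightarrow> En j \<le> En k"
    and It_items: "k \<in> {2..L} \<Longrightarrow> It k \<in> items I"
    and Pt_periods: "k \<in> {2..L} \<Longrightarrow> Pt k \<in> periods I"
    and weight_le_En: "k \<in> {2..L} \<Longrightarrow> weight I (It k) \<le> En k"
    and En_le_capacity: "k \<in> {2..L} \<Longrightarrow> En k \<le> capacity I (Pt k)"
    and pushed_good: "k \<in> {2..L} \<Longrightarrow>
      good q (profit I (It k) (Pt k)) (conf I It En Va (k - 1) (It k) (En k))"
    and Va_eq: "k \<in> {2..L} \<Longrightarrow>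
      Va k = profit I (It k) (Pt k) - conf I It En Va (k - 1) (It k) (En k)"
    and covered: "i \<in> items I \<Longrightarrow> t \<in> periods I \<Longrightarrow> weight I i \<le> e \<Longrightarrow> e \<le> capacity I t \<Longrightarrow>
      e < En L \<Longrightarrow> \<exists>l\<in>{1..L}. (\<forall>j\<in>{1..l}. En j \<le> e) \<and> \<not> good q (profit I i t) (conf I It En Va l i e)"
begin

lemma profit_split:
  assumes "k \<in> {2..L}"
  shows "profit I (It k) (Pt k) = Va k + conf I It En Va (k - 1) (It k) (En k)"
    and "0 < Va k" and "profit I (It k) (Pt k) \<le> q * Va k"
  using pushed_good[OF assms] Va_eq[OF assms] by (auto simp: good_def)

text \<open>All copies of the same item and period conflict with the topmost one through the item,
  so their values together are part of the sum into which the profit of the topmost entry splits. As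
  each value is at least \<open>1 / q\<close> of this same profit, there are at most
  \<open>q\<close> copies.\<close>

lemma fiber_card:
  assumes "i \<in> items I" "t \<in> periods I"
  shows "card {k \<in> {2..L}. It k = i \<and> Pt k = t} \<le> q"
proof (cases "{k \<in> {2..L}. It k = i \<and> Pt k = t} = {}")
  case True
  then show ?thesis by (metis card.empty le0)
next
  case False
  let ?F = "{k \<in> {2..L}. It k = i \<and> Pt k = t}"
  define k where "k = Max ?F"
  have "k \<in> ?F" unfolding k_def using False by (intro Max_in) auto
  then have k: "k \<in> {2..L}" "It k = i" "Pt k = t" by auto
  have sub: "?F - {k} \<subseteq> {j \<in> {1..k - 1}. It j = i \<or> En k < En j + weight I i}"
  proof
    fix j assume j: "j \<in> ?F - {k}"
    then have "j \<le> k" unfolding k_def by (intro Max_ge) auto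
    with j show "j \<in> {j \<in> {1..k - 1}. It j = i \<or> En k < En j + weight I i}" by auto
  qed
  have "sum Va ?F = Va k + sum Va (?F - {k})"
    using \<open>k \<in> ?F\<close> by (subst sum.remove[of _ k]) auto
  also have "\<dots> \<le> Va k + conf I It En Va (k - 1) i (En k)"
    unfolding conf_def by (intro add_left_mono sum_mono2 sub) auto
  also have "\<dots> = profit I i t" using profit_split(1)[OF k(1)] k by simp
  finally have 1: "sum Va ?F \<le> profit I i t" .
  have "card ?F * profit I i t \<le> (\<Sum>k\<in>?F. q * Va k)"
    using sum_bounded_below[of ?F "profit I i t" "\<lambda>k. q * Va k"] profit_split(3) by auto
  also have "\<dots> \<le> q * profit I i t" using 1 by (simp flip: sum_distrib_left)
  finally have "card ?F * profit I i t \<le> q * profit I i t" .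
  moreover have "0 < profit I i t" using profit_split(1,2)[OF k(1)] k by simp
  ultimately show ?thesis by simp
qed

lemma L_bound: "L \<le> 1 + n_items I * horizon I * q"
proof -
  let ?P = "items I \<times> periods I"
  have "card {2..L} = (\<Sum>y\<in>?P. card {k \<in> {2..L}. (It k, Pt k) = y})"
  proof -
    have "(\<lambda>k. (It k, Pt k)) ` {2..L} \<subseteq> ?P" using It_items Pt_periods by auto
    then show ?thesis
      using sum.group[of "{2..L}" ?P "\<lambda>k. (It k, Pt k)" "\<lambda>_. 1::nat"]
      by (simp add: items_def periods_def)
  qed
  also have "\<dots> \<le> (\<Sum>y\<in>?P. q)"
  proof (rule sum_mono)
    fix y assume "y \<in> ?P"
    then show "card {k \<in> {2..L}. (It k, Pt k) = y} \<le> q"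
      using fiber_card[of "fst y" "snd y"] by (cases y) auto
  qed
  also have "\<dots> = n_items I * horizon I * q" by (simp add: items_def periods_def)
  finally show ?thesis by simp
qed

text \<open>
  The conflict set of an interval of item \<open>i\<close> changes only when its left end passes the right end
  of a stacked interval; hence it suffices to try the ends \<open>max (En L) (En k + weight I i)\<close>.
\<close>

lemma candidate:
  assumes "weight I i \<le> e" "En L \<le> e"
  obtains k where "k \<in> {1..L}" "max (En L) (En k + weight I i) \<le> e"
    "conf I It En Va L i (max (En L) (En k + weight I i)) = conf I It En Va L i e"
proof -
  let ?A = "{k \<in> {1..L}. En k + weight I i \<le> e}"
  \<comment> \<open>\<open>k\<close> is the last entry that the interval ending at \<open>e\<close>
    does not overlap; the dummy makes \<open>?A\<close> nonempty. Moving the end down to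
    \<open>?e\<close> keeps the entries up to \<open>k\<close> clear and all later ones
    overlapping.\<close>
  define k where "k = Max ?A"
  have "1 \<in> ?A" using assms L_pos bottom by auto
  then have "k \<in> ?A" unfolding k_def by (intro Max_in) auto
  then have k: "k \<in> {1..L}" "En k + weight I i \<le> e" by auto
  let ?e = "max (En L) (En k + weight I i)"
  have le: "?e \<le> e" using k assms by simp
  have "(?e < En j + weight I i) = (e < En j + weight I i)" if j: "j \<in> {1..L}" for j
  proof (cases "j \<le> k")
    case True
    then have "En j \<le> En k" using En_mono j k by auto
    then show ?thesis using le by auto
  next
    case False
    have "j \<notin> ?A" using False unfolding k_def using Max_ge[of ?A j] by auto
    then show ?thesis using le j by auto
  qed
  then have "conf I It En Va L i ?e = conf I It En Va L i e"
    unfolding conf_def by (intro sum.cong) auto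
  with k(1) le show ?thesis by (rule that)
qed

definition ok :: "nat \<Rightarrow> nat \<Rightarrow> nat \<Rightarrow> bool" where
  "ok i t e \<longleftrightarrow> e \<le> capacity I t \<and> good q (profit I i t) (conf I It En Va L i e)"

text \<open>Ends below the top are covered by the invariant. Any other end has the conflict sum of
  some candidate end that is no later; that candidate lies below \<open>b\<close>, hence is not
  \<open>ok\<close>, and as it meets the capacity it must fail \<open>good\<close>.\<close>

lemma covered_below:
  assumes min: "\<And>i t k. i \<in> items I \<Longrightarrow> t \<in> periods I \<Longrightarrow> k \<in> {1..L} \<Longrightarrow>
      ok i t (max (En L) (En k + weight I i)) \<Longrightarrow> b \<le> max (En L) (En k + weight I i)"
    and it: "i \<in> items I" "t \<in> periods I" "weight I i \<le> e" "e \<le> capacity I t" "e < b"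
  shows "\<exists>l\<in>{1..L}. (\<forall>j\<in>{1..l}. En j \<le> e) \<and> \<not> good q (profit I i t) (conf I It En Va l i e)"
proof (cases "e < En L")
  case True
  with covered it show ?thesis by blast
next
  case False
  then have "En L \<le> e" by simp
  with it(3) obtain k where k: "k \<in> {1..L}" "max (En L) (En k + weight I i) \<le> e"
    "conf I It En Va L i (max (En L) (En k + weight I i)) = conf I It En Va L i e"
    by (rule candidate)
  have "\<not> ok i t (max (En L) (En k + weight I i))"
    using min[OF it(1,2) k(1)] k(2) it(5) by linarith
  then have "\<not> good q (profit I i t) (conf I It En Va L i e)"
    using k it(4) by (auto simp: ok_def)
  moreover have "\<forall>j\<in>{1..L}. En j \<le> e" using En_mono \<open>En L \<le> e\<close> by (meson atLeastAtMost_iff order.refl order.trans)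
  ultimately show ?thesis using L_pos by auto
qed

text \<open>Since \<open>b\<close> is the earliest acceptable end, everything ending before it is
  rejected against the present stack or a prefix of it, which yields \<open>covered\<close> for the
  new top. The other conditions survive because conflict sums of prefixes do not see the new
  cell.\<close>

lemma push:
  assumes min: "\<And>i t k. i \<in> items I \<Longrightarrow> t \<in> periods I \<Longrightarrow> k \<in> {1..L} \<Longrightarrow>
      ok i t (max (En L) (En k + weight I i)) \<Longrightarrow> b \<le> max (En L) (En k + weight I i)"
    and it: "i \<in> items I" "t \<in> periods I" "k \<in> {1..L}"
    and b: "b = max (En L) (En k + weight I i)" "ok i t b"
  shows "gik_stack I q (Suc L) (It(Suc L := i)) (Pt(Suc L := t)) (En(Suc L := b))
    (Va(Suc L := profit I i t - conf I It En Va L i b))"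
    (is "gik_stack I q (Suc L) ?It ?Pt ?En ?Va")
proof -
  have conf: "conf I ?It ?En ?Va l = conf I It En Va l" if "l \<le> L" for l
    using that by (intro ext conf_cong) auto
  have cases: "k \<in> {2..L} \<or> k = Suc L" if "k \<in> {2..Suc L}" for k using that by auto
  show ?thesis
  proof
    show "gik_instance I" by (rule inst)
    show "1 \<le> Suc L" by simp
    show "?It 1 = 0" "?En 1 = 0" "?Va 1 = 0" using L_pos bottom by auto
    show "?En j \<le> ?En k" if "1 \<le> j" "j \<le> k" "k \<le> Suc L" for j k
    proof (cases "j = Suc L")
      case False
      then have "En j \<le> En L" using that by (intro En_mono) auto
      then show ?thesis using that False En_mono[of j k] b by auto
    qed (use that in auto)
  next
    fix k assume k: "k \<in> {2..Suc L}"
    show "?It k \<in> items I" "?Pt k \<in> periods I" "weight I (?It k) \<le> ?En k"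
      "?En k \<le> capacity I (?Pt k)"
      using cases[OF k] It_items Pt_periods weight_le_En En_le_capacity it b
      by (auto simp: ok_def)
    have "conf I ?It ?En ?Va (k - 1) = conf I It En Va (k - 1)"
      using k by (intro conf) auto
    then show "good q (profit I (?It k) (?Pt k)) (conf I ?It ?En ?Va (k - 1) (?It k) (?En k))"
      "?Va k = profit I (?It k) (?Pt k) - conf I ?It ?En ?Va (k - 1) (?It k) (?En k)"
      using cases[OF k] pushed_good Va_eq b by (auto simp: ok_def)
  next
    fix i' t' e
    assume e: "i' \<in> items I" "t' \<in> periods I" "weight I i' \<le> e" "e \<le> capacity I t'" "e < ?En (Suc L)"
    then obtain l where "l\<in>{1..L}" "\<forall>j\<in>{1..l}. En j \<le> e"
      "\<not> good q (profit I i' t') (conf I It En Va l i' e)"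
    proof -
      have "\<exists>l\<in>{1..L}. (\<forall>j\<in>{1..l}. En j \<le> e) \<and>
          \<not> good q (profit I i' t') (conf I It En Va l i' e)"
        by (rule covered_below[OF min]) (use e in auto)
      then show thesis using that by blast
    qed
    then show "\<exists>l\<in>{1..Suc L}. (\<forall>j\<in>{1..l}. ?En j \<le> e) \<and>
        \<not> good q (profit I i' t') (conf I ?It ?En ?Va l i' e)"
      using conf[of l] by (intro bexI[of _ l]) auto
  qed
qed

end

lemma gik_stack_init:
  assumes "gik_instance I"
  shows "gik_stack I q 1 (\<lambda>_. 0) (\<lambda>_. 0) (\<lambda>_. 0) (\<lambda>_. 0)"
  using assms by unfold_locales auto

text \<open>A feasible chain packs its items one after the other, in the order of insertion.\<close>

lemma feasible_chain_schedule:
  assumes inst: "gik_instance I" and "feasible_chain I S"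
  obtains A \<tau> e where "A \<subseteq> items I"
    "\<And>i. i \<in> A \<Longrightarrow> \<tau> i \<in> periods I \<and> weight I i \<le> e i \<and> e i \<le> capacity I (\<tau> i)"
    "\<And>i j. i \<in> A \<Longrightarrow> j \<in> A \<Longrightarrow> i \<noteq> j \<Longrightarrow> e i + weight I j \<le> e j \<or> e j + weight I i \<le> e i"
    "chain_profit I S = (\<Sum>i\<in>A. profit I i (\<tau> i))"
proof -
  define A where "A = S (horizon I)"
  define \<tau> where "\<tau> i = (LEAST t. i \<in> S t)" for i
  define before where "before i j \<longleftrightarrow> \<tau> i < \<tau> j \<or> \<tau> i = \<tau> j \<and> i \<le> j" for i j
  \<comment> \<open>Completion time when the items are packed in the order \<open>before\<close>;
    this order is reflexive, so the weight of \<open>i\<close> itself is included.\<close>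
  define e where "e i = (\<Sum>j | j \<in> A \<and> before j i. weight I j)" for i
  have chain: "is_chain I S" and cap: "\<And>t. t \<in> periods I \<Longrightarrow> (\<Sum>i\<in>S t. weight I i) \<le> capacity I t"
    using assms by (auto simp: feasible_chain_def)
  have S0: "S 0 = {}" using chain by (simp add: is_chain_def)
  have A: "A \<subseteq> items I" using chain by (simp add: is_chain_def A_def)
  then have fin: "finite A" using finite_subset by (auto simp: items_def)
  have mono: "S s \<subseteq> S t" if "s \<le> t" "t \<le> horizon I" for s t
    using that
  proof (induction t rule: dec_induct)
    case (step t)
    then have "S (Suc t - 1) \<subseteq> S (Suc t)" using chain step
      unfolding is_chain_def periods_def by (metis Suc_leI atLeastAtMost_iff le_add1 plus_1_eq_Suc)
    with step show ?case by auto
  qed auto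
  have \<tau>: "i \<in> S (\<tau> i)" "\<tau> i \<in> periods I" if "i \<in> A" for i
  proof -
    show 1: "i \<in> S (\<tau> i)" unfolding \<tau>_def using that by (intro LeastI) (simp add: A_def)
    have "\<tau> i \<le> horizon I" unfolding \<tau>_def using that by (intro Least_le) (simp add: A_def)
    moreover have "\<tau> i \<noteq> 0" using 1 S0 by (metis empty_iff)
    ultimately show "\<tau> i \<in> periods I" by (auto simp: periods_def)
  qed
  have in_S: "i \<in> S t \<longleftrightarrow> i \<in> A \<and> \<tau> i \<le> t" if "t \<le> horizon I" for i t
  proof
    assume "i \<in> S t"
    then show "i \<in> A \<and> \<tau> i \<le> t" using mono[of t "horizon I"] that
      by (auto simp: A_def \<tau>_def intro: Least_le)
  next
    assume "i \<in> A \<and> \<tau> i \<le> t"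
    then show "i \<in> S t" using \<tau>(1) mono that by blast
  qed
  show thesis
  proof
    show "A \<subseteq> items I" by (rule A)
    fix i assume i: "i \<in> A"
    have "weight I i \<le> e i" unfolding e_def
      using i fin by (intro member_le_sum) (auto simp: before_def)
    \<comment> \<open>Everything packed up to \<open>i\<close> is already in
      \<open>S (\<tau> i)\<close>, so the capacity of that period bounds the end.\<close>
    moreover have "e i \<le> (\<Sum>j\<in>S (\<tau> i). weight I j)" unfolding e_def
    proof (rule sum_mono2)
      show "finite (S (\<tau> i))" using mono[of "\<tau> i" "horizon I"] \<tau>(2)[OF i] fin
        by (auto simp: A_def periods_def intro: finite_subset)
      show "{j. j \<in> A \<and> before j i} \<subseteq> S (\<tau> i)"
      proof
        fix j assume "j \<in> {j. j \<in> A \<and> before j i}"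
        then have "j \<in> A \<and> \<tau> j \<le> \<tau> i" by (auto simp: before_def)
        moreover have "\<tau> i \<le> horizon I" using \<tau>(2)[OF i] by (simp add: periods_def)
        ultimately show "j \<in> S (\<tau> i)" using in_S by blast
      qed
    qed auto
    ultimately show "\<tau> i \<in> periods I \<and> weight I i \<le> e i \<and> e i \<le> capacity I (\<tau> i)"
      using cap[OF \<tau>(2)[OF i]] \<tau>(2)[OF i] by linarith
  next
    have less: "e i + weight I j \<le> e j" if "i \<in> A" "j \<in> A" "i \<noteq> j" "before i j" for i j
    proof -
      have "e i + weight I j = (\<Sum>k\<in>insert j {k. k \<in> A \<and> before k i}. weight I k)"
        unfolding e_def using fin that by (subst sum.insert) (auto simp: before_def)
      also have "\<dots> \<le> e j" unfolding e_def
        using fin that by (intro sum_mono2) (auto simp: before_def)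
      finally show ?thesis .
    qed
    fix i j assume "i \<in> A" "j \<in> A" "i \<noteq> j"
    moreover have "before i j \<or> before j i" by (auto simp: before_def)
    ultimately show "e i + weight I j \<le> e j \<or> e j + weight I i \<le> e i" using less by auto
  next
    have "chain_profit I S = (\<Sum>t\<in>periods I. \<Sum>i\<in>{i \<in> A. \<tau> i = t}. profit I i (\<tau> i))"
      unfolding chain_profit_def
    proof (intro sum.cong refl)
      fix t assume t: "t \<in> periods I"
      then show "S t - S (t - 1) = {i \<in> A. \<tau> i = t}"
        using in_S[of t] in_S[of "t - 1"] by (auto simp: periods_def)
    qed auto
    also have "\<dots> = (\<Sum>i\<in>A. profit I i (\<tau> i))"
      using fin \<tau>(2) by (intro sum.group) (auto simp: periods_def)
    finally show "chain_profit I S = (\<Sum>i\<in>A. profit I i (\<tau> i))" .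
  qed
qed

lemma sum_UN_le:
  fixes f :: "'a \<Rightarrow> nat"
  assumes "finite A" "\<And>x. x \<in> A \<Longrightarrow> finite (B x)"
  shows "sum f (\<Union>x\<in>A. B x) \<le> (\<Sum>x\<in>A. sum f (B x))"
  using assms
proof (induction A rule: finite_induct)
  case (insert x A)
  have "sum f (\<Union>y\<in>insert x A. B y) \<le> sum f (B x) + sum f (\<Union>y\<in>A. B y)"
    using insert.prems sum_Un_nat[of "B x" "\<Union>y\<in>A. B y" f] insert.hyps by simp
  with insert show ?case by fastforce
qed simp

section \<open>Local ratio bounds: the optimum against the stack, and the stack against a
  selection\<close>

context gik_stack
begin

text \<open>Each interval of an optimal schedule is rejected by its own prefix, so \<open>q\<close>
  times its conflict sum pays for \<open>q - 1\<close> times its profit. After exchanging the sums,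
  a stacked value is charged at most once through its item and at most once through its right end.
  Counting the items instead improves the factor to 1 for a single item.\<close>

lemma max_profit_le:
  assumes none: "\<And>i t k. i \<in> items I \<Longrightarrow> t \<in> periods I \<Longrightarrow> k \<in> {1..L} \<Longrightarrow>
      \<not> ok i t (max (En L) (En k + weight I i))"
  shows "(q - 1) * max_profit I \<le> q * (min 2 (n_items I) * sum Va {2..L})"
proof -
  obtain S where S: "feasible_chain I S" "chain_profit I S = max_profit I"
    using max_profit_attained by auto
  obtain A \<tau> e where A: "A \<subseteq> items I"
    and \<tau>: "\<And>i. i \<in> A \<Longrightarrow> \<tau> i \<in> periods I \<and> weight I i \<le> e i \<and> e i \<le> capacity I (\<tau> i)"
    and disj: "\<And>i j. i \<in> A \<Longrightarrow> j \<in> A \<Longrightarrow> i \<noteq> j \<Longrightarrow> e i + weight I j \<le> e j \<or> e j + weight I i \<le> e i"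
    and profit: "chain_profit I S = (\<Sum>i\<in>A. profit I i (\<tau> i))"
    using feasible_chain_schedule[OF inst S(1)] by blast
  have fin: "finite A" using A finite_subset by (auto simp: items_def)
  have "\<exists>l. l \<in> {1..L} \<and> (\<forall>j\<in>{1..l}. En j \<le> e i) \<and>
      \<not> good q (profit I i (\<tau> i)) (conf I It En Va l i (e i))" if "i \<in> A" for i
  proof -
    have "\<exists>l\<in>{1..L}. (\<forall>j\<in>{1..l}. En j \<le> e i) \<and>
        \<not> good q (profit I i (\<tau> i)) (conf I It En Va l i (e i))"
      \<comment> \<open>With no acceptable candidate the minimality premise holds vacuously for
        every bound, so a bound just above \<open>e i\<close> will do.\<close>
      by (rule covered_below[where b = "Suc (e i)"]) (use none \<tau>[OF that] A that in auto)
    then show ?thesis by blast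
  qed
  then obtain l where l: "\<And>i. i \<in> A \<Longrightarrow> l i \<in> {1..L} \<and> (\<forall>j\<in>{1..l i}. En j \<le> e i) \<and>
      \<not> good q (profit I i (\<tau> i)) (conf I It En Va (l i) i (e i))"
    by metis
  let ?c = "\<lambda>i j. j \<le> l i \<and> (It j = i \<or> e i < En j + weight I i)"
  have count: "card {i \<in> A. ?c i j} \<le> min 2 (n_items I)" if j: "j \<in> {1..L}" for j
  proof -
    \<comment> \<open>These optimal intervals contain the point \<open>En j\<close>, because
      \<open>En j \<le> e i\<close> for every \<open>j\<close> in the prefix; disjoint intervals
      cannot share it.\<close>
    let ?B = "{i \<in> A. j \<le> l i \<and> e i < En j + weight I i}"
    have unique: "i = i'" if "i \<in> ?B" "i' \<in> ?B" for i i'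
    proof (rule ccontr)
      assume "i \<noteq> i'"
      moreover have "En j \<le> e i" "En j \<le> e i'" using l that j by auto
      ultimately show False using disj[of i i'] that by auto
    qed
    have "finite ?B" using fin by simp
    then have "card ?B \<le> 1" unfolding One_nat_def
      by (rule iffD2[OF card_le_Suc0_iff_eq]) (intro ballI unique)
    moreover have "card {i \<in> A. ?c i j} \<le> card (insert (It j) ?B)"
      using fin by (intro card_mono) auto
    moreover have "card (insert (It j) ?B) \<le> Suc (card ?B)"
      using fin by (simp add: card_insert_if)
    ultimately have "card {i \<in> A. ?c i j} \<le> 2" by linarith
    moreover have "card {i \<in> A. ?c i j} \<le> card (items I)"
      using A by (intro card_mono) (auto simp: items_def)
    ultimately show ?thesis by (simp add: items_def)
  qed
  have "(q - 1) * max_profit I = (\<Sum>i\<in>A. (q - 1) * profit I i (\<tau> i))"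
    unfolding S(2)[symmetric] profit by (simp add: sum_distrib_left)
  also have "\<dots> \<le> (\<Sum>i\<in>A. q * conf I It En Va (l i) i (e i))"
    using l by (intro sum_mono not_goodD) auto
  also have "\<dots> = q * (\<Sum>i\<in>A. \<Sum>j\<in>{1..L}. if ?c i j then Va j else 0)"
  proof -
    have "conf I It En Va (l i) i (e i) = (\<Sum>j\<in>{1..L}. if ?c i j then Va j else 0)" if "i \<in> A" for i
    proof -
      have "{j \<in> {1..l i}. It j = i \<or> e i < En j + weight I i} = {j \<in> {1..L}. ?c i j}"
        using l[OF that] by auto
      then show ?thesis unfolding conf_def by (simp only: sum.inter_filter finite_atLeastAtMost)
    qed
    then show ?thesis by (simp add: sum_distrib_left)
  qed
  also have "\<dots> = q * (\<Sum>j\<in>{1..L}. \<Sum>i\<in>A. if ?c i j then Va j else 0)"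
    by (subst sum.swap) simp
  also have "\<dots> = q * (\<Sum>j\<in>{1..L}. card {i \<in> A. ?c i j} * Va j)"
    using fin by (simp add: sum.inter_filter[symmetric])
  also have "\<dots> \<le> q * (\<Sum>j\<in>{1..L}. min 2 (n_items I) * Va j)"
    using count by (intro mult_le_mono2 sum_mono mult_le_mono1)
  also have "\<dots> = q * (min 2 (n_items I) * sum Va {1..L})" by (simp add: sum_distrib_left)
  also have "sum Va {1..L} = sum Va {2..L}"
    using L_pos bottom(3) by (subst sum.atLeast_Suc_atMost) (simp_all add: numeral_2_eq_2)
  finally show ?thesis .
qed

definition selection :: "nat set \<Rightarrow> bool" where
  "selection R \<longleftrightarrow> R \<subseteq> {2..L} \<and> inj_on It R \<and>
     (\<forall>k\<in>R. \<forall>k'\<in>R. k < k' \<longrightarrow> En k + weight I (It k') \<le> En k')"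

text \<open>Outside the periods the value is fixed to the empty set, so that the chain can coincide
  with \<open>output_chain\<close> as a function.\<close>

definition selected_chain :: "nat set \<Rightarrow> nat \<Rightarrow> nat set" where
  "selected_chain R t = (if t \<in> periods I then {i \<in> items I. \<exists>k\<in>R. It k = i \<and> Pt k \<le> t} else {})"

lemma selected_chain_eq:
  assumes "selection R" "t \<in> periods I"
  shows "selected_chain R t = It ` {k \<in> R. Pt k \<le> t}"
  using assms It_items by (auto simp: selected_chain_def selection_def)

text \<open>A weight is the number of integer points of its half-open interval. The intervals
  selected for periods up to \<open>t\<close> are disjoint subsets of
  \<open>{1..capacity I t}\<close>, so counting points bounds the total weight.\<close>

lemma feasible_selected_chain:
  assumes R: "selection R"
  shows "feasible_chain I (selected_chain R)"
  unfolding feasible_chain_def is_chain_def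
proof (intro conjI ballI)
  show "selected_chain R 0 = {}" by (simp add: selected_chain_def periods_def)
  show "selected_chain R (horizon I) \<subseteq> items I" by (auto simp: selected_chain_def)
  fix t assume t: "t \<in> periods I"
  show "selected_chain R (t - 1) \<subseteq> selected_chain R t"
    using t le_trans[of _ "t - 1" t] by (auto simp: selected_chain_def split: if_splits)
  let ?R = "{k \<in> R. Pt k \<le> t}"
  let ?J = "\<lambda>k. {En k - weight I (It k)<..En k}"
  have sub: "?R \<subseteq> {2..L}" "finite ?R" using R by (auto simp: selection_def intro: finite_subset)
  have "(\<Sum>i\<in>selected_chain R t. weight I i) = (\<Sum>k\<in>?R. weight I (It k))"
    using R t by (subst selected_chain_eq, simp, simp, subst sum.reindex)
      (auto simp: selection_def intro: inj_on_subset)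
  also have "\<dots> = (\<Sum>k\<in>?R. card (?J k))"
    using sub weight_le_En by (intro sum.cong) auto
  also have "\<dots> = card (\<Union>k\<in>?R. ?J k)"
  proof (rule card_UN_disjoint[symmetric])
    show "\<forall>k\<in>?R. \<forall>k'\<in>?R. k \<noteq> k' \<longrightarrow> ?J k \<inter> ?J k' = {}"
    proof (intro ballI impI)
      fix k k' assume "k \<in> ?R" "k' \<in> ?R" "k \<noteq> k'"
      then have "En k + weight I (It k') \<le> En k' \<or> En k' + weight I (It k) \<le> En k"
        using R unfolding selection_def by (metis (lifting) linorder_neqE_nat mem_Collect_eq)
      then show "?J k \<inter> ?J k' = {}" by auto
    qed
  qed (use sub in auto)
  also have "\<dots> \<le> card {1..capacity I t}"
  proof (rule card_mono)
    have "En k \<le> capacity I t" if "k \<in> ?R" for k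
    proof -
      have k: "k \<in> {2..L}" using that sub by auto
      have "En k \<le> capacity I (Pt k)" using En_le_capacity k by blast
      also have "\<dots> \<le> capacity I t"
        using inst Pt_periods[OF k] t that by (auto simp: gik_instance_def)
      finally show ?thesis .
    qed
    then show "(\<Union>k\<in>?R. ?J k) \<subseteq> {1..capacity I t}" by fastforce
  qed simp
  finally show "(\<Sum>i\<in>selected_chain R t. weight I i) \<le> capacity I t" by simp
qed

lemma chain_profit_selected:
  assumes R: "selection R"
  shows "chain_profit I (selected_chain R) = (\<Sum>k\<in>R. profit I (It k) (Pt k))"
proof -
  have inj: "inj_on It R" and sub: "R \<subseteq> {2..L}" using R by (auto simp: selection_def)
  then have fin: "finite R" by (auto intro: finite_subset)
  have "chain_profit I (selected_chain R) =
      (\<Sum>t\<in>periods I. \<Sum>k\<in>{k \<in> R. Pt k = t}. profit I (It k) (Pt k))"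
    unfolding chain_profit_def
  proof (rule sum.cong[OF refl])
    fix t assume t: "t \<in> periods I"
    have "selected_chain R t - selected_chain R (t - 1) = It ` {k \<in> R. Pt k = t}"
    proof (cases "t - 1 \<in> periods I")
      case True
      then have *: "k \<le> t \<and> \<not> k \<le> t - 1 \<longleftrightarrow> k = t" for k using t by (auto simp: periods_def)
      have "It ` {k \<in> R. Pt k \<le> t} - It ` {k \<in> R. Pt k \<le> t - 1} =
          It ` ({k \<in> R. Pt k \<le> t} - {k \<in> R. Pt k \<le> t - 1})"
        using inj by (intro inj_on_image_set_diff[symmetric, of It R]) auto
      also have "{k \<in> R. Pt k \<le> t} - {k \<in> R. Pt k \<le> t - 1} = {k \<in> R. Pt k = t}"
        using * by blast
      finally show ?thesis using selected_chain_eq[OF R] True t by simp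
    next
      case False
      \<comment> \<open>The predecessor of the first period is 0, where the chain is empty by
        definition; no entry of \<open>R\<close> has period 0.\<close>
      then have "t = 1" using t by (auto simp: periods_def)
      moreover have "Pt k \<le> 1 \<longleftrightarrow> Pt k = 1" if "k \<in> R" for k
        using Pt_periods[of k] sub that by (auto simp: periods_def)
      ultimately have "{k \<in> R. Pt k \<le> t} = {k \<in> R. Pt k = t}" by auto
      then show ?thesis using selected_chain_eq[OF R t] False by (simp add: selected_chain_def)
    qed
    then show "(\<Sum>i\<in>selected_chain R t - selected_chain R (t - 1). profit I i t) =
        (\<Sum>k\<in>{k \<in> R. Pt k = t}. profit I (It k) (Pt k))"
      using inj by (simp, subst sum.reindex) (auto intro: inj_on_subset)
  qed
  also have "\<dots> = (\<Sum>k\<in>R. profit I (It k) (Pt k))"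
    using fin sub Pt_periods by (intro sum.group) (auto simp: periods_def)
  finally show ?thesis .
qed

text \<open>The profit of an entry is its own value plus the values of the earlier entries in
  conflict with it. By maximality every entry is selected or is such an earlier conflict of a
  selected one, so each value is paid for at least once.\<close>

lemma selection_profit_ge:
  assumes R: "selection R"
    and maximal: "\<And>k. k \<in> {2..L} - R \<Longrightarrow>
      \<exists>k'\<in>R. k < k' \<and> (It k = It k' \<or> En k' < En k + weight I (It k'))"
  shows "sum Va {2..L} \<le> (\<Sum>k\<in>R. profit I (It k) (Pt k))"
proof -
  let ?C = "\<lambda>k. {j \<in> {1..k - 1}. It j = It k \<or> En k < En j + weight I (It k)}"
  have sub: "R \<subseteq> {2..L}" using R by (auto simp: selection_def)
  then have fin: "finite R" by (auto intro: finite_subset)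
  have "{2..L} \<subseteq> (\<Union>k\<in>R. insert k (?C k))"
  proof
    fix k assume k: "k \<in> {2..L}"
    show "k \<in> (\<Union>k\<in>R. insert k (?C k))"
    proof (cases "k \<in> R")
      case False
      with k maximal obtain k' where "k' \<in> R" "k < k'" "It k = It k' \<or> En k' < En k + weight I (It k')"
        by blast
      with k have "k \<in> ?C k'" by auto
      with \<open>k' \<in> R\<close> show ?thesis by blast
    qed auto
  qed
  then have "sum Va {2..L} \<le> sum Va (\<Union>k\<in>R. insert k (?C k))"
    using fin by (intro sum_mono2) auto
  also have "\<dots> \<le> (\<Sum>k\<in>R. sum Va (insert k (?C k)))"
    using fin by (intro sum_UN_le) auto
  also have "\<dots> = (\<Sum>k\<in>R. profit I (It k) (Pt k))"
  proof (rule sum.cong[OF refl])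
    fix k assume "k \<in> R"
    then have "k \<in> {2..L}" using sub by auto
    then show "sum Va (insert k (?C k)) = profit I (It k) (Pt k)"
      by (subst sum.insert) (auto simp: profit_split(1) conf_def)
  qed
  finally show ?thesis .
qed

end

section \<open>Counting elementary steps\<close>

text \<open>A unit-cost copy of \<open>run\<close>, which separates the counting of iterations from
  the bounding of operand lengths; \<open>steps_run\<close> converts a step count into logarithmic
  cost.\<close>

inductive steps :: "com \<Rightarrow> memory \<Rightarrow> nat \<Rightarrow> memory \<Rightarrow> bool" where
  steps_Skip: "steps Skip m 1 m"
| steps_Write: "steps (Write x a e) m 1 (m(x := (m x)(val a m := val e m)))"
| steps_Seq: "steps c m k m' \<Longrightarrow> steps d m' l m'' \<Longrightarrow> steps (Seq c d) m (k + l) m''"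
| steps_If_True: "val b m \<noteq> 0 \<Longrightarrow> steps c m k m' \<Longrightarrow> steps (If b c d) m (Suc k) m'"
| steps_If_False: "val b m = 0 \<Longrightarrow> steps d m k m' \<Longrightarrow> steps (If b c d) m (Suc k) m'"
| steps_While_False: "val b m = 0 \<Longrightarrow> steps (While b c) m 1 m"
| steps_While_True: "val b m \<noteq> 0 \<Longrightarrow> steps c m k m' \<Longrightarrow> steps (While b c) m' l m'' \<Longrightarrow>
    steps (While b c) m (Suc (k + l)) m''"

definition bounded :: "nat \<Rightarrow> memory \<Rightarrow> bool" where
  "bounded B m \<longleftrightarrow> (\<forall>x a. m x a < 2 ^ B)"

lemma bounded_mono: "bounded B m \<Longrightarrow> B \<le> B' \<Longrightarrow> bounded B' m"
  unfolding bounded_def by (meson order_less_le_trans one_le_numeral power_increasing)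

lemma bits_le:
  assumes "k < 2 ^ B" "1 \<le> B"
  shows "bits k \<le> B"
  using assms by (simp add: bits_def floorlog_le_iff)

lemma less_two_power_bits: "k < 2 ^ bits k"
proof -
  have "k < 2 ^ floorlog 2 k"
    using floorlog_le_iff[of 2 k "floorlog 2 k"] by simp
  also have "\<dots> \<le> 2 ^ bits k" by (simp add: bits_def)
  finally show ?thesis .
qed

text \<open>
  With all cells below \<open>2 ^ B\<close>, the value of \<open>e\<close> has at most \<open>width e * B\<close> bits and its
  evaluation costs at most \<open>price e * B\<close>.
\<close>

fun width :: "exp \<Rightarrow> nat" where
  "width (Const k) = Suc k"
| "width (Read x e) = 1"
| "width (Bin f a b) = width a + width b"

fun price :: "exp \<Rightarrow> nat" where
  "price (Const k) = Suc k"
| "price (Read x e) = price e + width e + 1"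
| "price (Bin f a b) = price a + price b + width a + width b"

lemma width_pos: "1 \<le> width e"
  by (induction e) auto

lemma val_less:
  assumes "bounded B m" "1 \<le> B"
  shows "val e m < 2 ^ (width e * B)"
proof (induction e)
  case (Const k)
  have "k < 2 ^ Suc k" by (metis less_exp lessI order.strict_trans power_strict_increasing_iff one_less_numeral_iff semiring_norm(76))
  also have "\<dots> \<le> 2 ^ (Suc k * B)"
    using mult_le_mono2[OF assms(2), of "Suc k"] by (intro power_increasing) auto
  finally show ?case by simp
next
  case (Read x e)
  then show ?case using assms by (simp add: bounded_def)
next
  case (Bin f a b)
  let ?x = "2 ^ (width a * B) :: nat" and ?y = "2 ^ (width b * B) :: nat"
  have ge: "2 \<le> ?x" "2 \<le> ?y"
    using power_increasing[of 1 "width a * B" "2::nat"] power_increasing[of 1 "width b * B" "2::nat"]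
      assms width_pos[of a] width_pos[of b] by (auto simp: Suc_le_eq)
  \<comment> \<open>Sums are reduced to products: both bounds are at least 2, hence a single bound
    covers every operator.\<close>
  have "x + y \<le> x * y" if "2 \<le> x" "2 \<le> y" for x y :: nat
    using mult_le_mono1[OF that(1), of y] mult_le_mono2[OF that(2), of x] by linarith
  then have "?x + ?y \<le> ?x * ?y" using ge by blast
  moreover have "?x \<le> ?x * ?y" by simp
  moreover have "val a m * val b m < ?x * ?y" using Bin by (intro mult_strict_mono') auto
  moreover have "val a m div val b m < ?x"
    using Bin.IH(1) by (rule order_le_less_trans[OF div_le_dividend])
  moreover have "?x * ?y = 2 ^ (width (Bin f a b) * B)" by (simp add: algebra_simps power_add)
  ultimately show ?case using Bin by (cases f) (simp_all; linarith)+
qed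

lemma bits_val_le:
  assumes "bounded B m" "1 \<le> B"
  shows "bits (val e m) \<le> width e * B"
  using val_less[OF assms] assms(2) width_pos[of e] by (intro bits_le) auto

lemma cost_le:
  assumes "bounded B m" "1 \<le> B"
  shows "cost e m \<le> price e * B"
proof (induction e)
  case (Const k)
  show ?case using bits_val_le[OF assms, of "Const k"] by (simp only: cost.simps price.simps val.simps width.simps)
next
  case (Read x e)
  have "bits (m x (val e m)) \<le> B" using bits_val_le[OF assms, of "Read x e"] by simp
  then show ?case using Read bits_val_le[OF assms, of e] by (simp add: algebra_simps)
next
  case (Bin f a b)
  then show ?case using bits_val_le[OF assms, of a] bits_val_le[OF assms, of b]
    by (simp add: algebra_simps)
qed

text \<open>Expressions without products enlarge the memory by a constant number of bits.\<close>

fun linear_exp :: "exp \<Rightarrow> bool" where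
  "linear_exp (Const k) = True"
| "linear_exp (Read x e) = True"
| "linear_exp (Bin f a b) = (f \<noteq> Mul \<and> linear_exp a \<and> linear_exp b)"

fun growth_exp :: "exp \<Rightarrow> nat" where
  "growth_exp (Const k) = k"
| "growth_exp (Read x e) = 0"
| "growth_exp (Bin f a b) = Suc (max (growth_exp a) (growth_exp b))"

lemma val_less_growth:
  assumes "bounded B m"
  shows "linear_exp e \<Longrightarrow> val e m < 2 ^ (B + growth_exp e)"
proof (induction e)
  case (Const k)
  have "k < 2 ^ k" by simp
  also have "\<dots> \<le> 2 ^ (B + k)" by (intro power_increasing) auto
  finally show ?case by simp
next
  case (Read x e)
  then show ?case using assms by (simp add: bounded_def)
next
  case (Bin f a b)
  let ?g = "B + max (growth_exp a) (growth_exp b)"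
  have "val a m < 2 ^ ?g" "val b m < 2 ^ ?g"
  proof -
    have "(2::nat) ^ (B + growth_exp a) \<le> 2 ^ ?g" "(2::nat) ^ (B + growth_exp b) \<le> 2 ^ ?g"
      by (intro power_increasing; simp)+
    moreover have "val a m < 2 ^ (B + growth_exp a)" "val b m < 2 ^ (B + growth_exp b)"
      using Bin by auto
    ultimately show "val a m < 2 ^ ?g" "val b m < 2 ^ ?g" by linarith+
  qed
  moreover from this(1) have "val a m div val b m < 2 ^ ?g"
    by (rule order_le_less_trans[OF div_le_dividend])
  ultimately have "val (Bin f a b) m < 2 ^ ?g + 2 ^ ?g"
    using Bin.prems by (cases f) auto
  then show ?case by simp
qed

text \<open>Only written values are constrained. Products may occur in tests and in addresses, where
  they cost time but do not lengthen any cell.\<close>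

fun linear :: "com \<Rightarrow> bool" where
  "linear Skip = True"
| "linear (Write x a e) = linear_exp e"
| "linear (Seq c d) = (linear c \<and> linear d)"
| "linear (If b c d) = (linear c \<and> linear d)"
| "linear (While b c) = linear c"

fun growth :: "com \<Rightarrow> nat" where
  "growth Skip = 0"
| "growth (Write x a e) = growth_exp e"
| "growth (Seq c d) = growth c + growth d"
| "growth (If b c d) = growth c + growth d"
| "growth (While b c) = growth c"

text \<open>Adding over the program text gives one number that bounds, per bit of cell length, the
  cost of each single step of every subprogram; in the same way \<open>growth\<close> bounds the
  bits that a single write can add.\<close>

fun fee :: "com \<Rightarrow> nat" where
  "fee Skip = 1"
| "fee (Write x a e) = price a + price e + width a + width e"
| "fee (Seq c d) = fee c + fee d"
| "fee (If b c d) = price b + width b + fee c + fee d"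
| "fee (While b c) = price b + width b + fee c"

text \<open>
  It therefore suffices to count steps: in \<open>N\<close> steps the memory grows by \<open>O(N)\<close> bits, so that
  every step costs \<open>O(B + N)\<close>.
\<close>

lemma steps_run_aux:
  assumes "steps c m N m'" "linear c" "fee c \<le> M" "growth c \<le> G" "bounded B m" "1 \<le> B"
  shows "\<exists>k. run c m k m' \<and> k \<le> M * N * (B + G * N) \<and> bounded (B + G * N) m'"
  using assms
proof (induction arbitrary: B rule: steps.induct)
  case (steps_Skip m)
  have "1 * 1 * 1 \<le> M * 1 * (B + G * 1)" using steps_Skip by (intro mult_le_mono) auto
  moreover have "bounded (B + G * 1) m" using steps_Skip by (auto intro: bounded_mono)
  ultimately show ?case using run_Skip by force
next
  case (steps_Write x a e m)
  let ?k = "cost a m + cost e m + bits (val a m) + bits (val e m)"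
  have "?k \<le> fee (Write x a e) * B"
    using cost_le[OF steps_Write(4,5), of a] cost_le[OF steps_Write(4,5), of e]
      bits_val_le[OF steps_Write(4,5), of a] bits_val_le[OF steps_Write(4,5), of e]
    by (simp add: algebra_simps)
  also have "\<dots> \<le> M * 1 * (B + G * 1)" using steps_Write by (intro mult_le_mono) auto
  finally have "?k \<le> M * 1 * (B + G * 1)" .
  moreover have "bounded (B + G * 1) (m(x := (m x)(val a m := val e m)))"
  proof -
    have "bounded (B + G * 1) m" using steps_Write(4) by (rule bounded_mono) simp
    moreover have "val e m < 2 ^ (B + growth_exp e)"
      using steps_Write by (intro val_less_growth) auto
    moreover have "(2::nat) ^ (B + growth_exp e) \<le> 2 ^ (B + G * 1)"
      using steps_Write by (intro power_increasing) auto
    ultimately have "bounded (B + G * 1) m" "val e m < 2 ^ (B + G * 1)" by linarith+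
    then show ?thesis by (auto simp: bounded_def)
  qed
  ultimately show ?case using run_Write by blast
next
  case (steps_Seq c m k m' d l m'')
  obtain k1 where k1: "run c m k1 m'" "k1 \<le> M * k * (B + G * k)" "bounded (B + G * k) m'"
    using steps_Seq.IH(1)[of B] steps_Seq.prems by auto
  \<comment> \<open>The second program starts from cells of up to \<open>B + G * k\<close> bits,
    which is why the induction generalises over \<open>B\<close>; both costs are then estimated with
    the final length.\<close>
  obtain k2 where k2: "run d m' k2 m''" "k2 \<le> M * l * (B + G * k + G * l)"
    "bounded (B + G * k + G * l) m''"
    using steps_Seq.IH(2)[of "B + G * k"] steps_Seq.prems k1 by auto
  have "k1 \<le> M * k * (B + G * (k + l))"
    using k1(2) by (rule order_trans) (intro mult_le_mono2 add_left_mono, simp)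
  then have "k1 + k2 \<le> M * (k + l) * (B + G * (k + l))" using k2(2) by (simp add: algebra_simps)
  then show ?case using run_Seq[OF k1(1) k2(1)] k2(3) by (auto simp: algebra_simps)
next
  case (steps_If_True b m c k m' d)
  obtain k1 where k1: "run c m k1 m'" "k1 \<le> M * k * (B + G * k)" "bounded (B + G * k) m'"
    using steps_If_True.IH[of B] steps_If_True.prems by auto
  have "cost b m + bits (val b m) \<le> (price b + width b) * B"
    using cost_le[of B m b] bits_val_le[of B m b] steps_If_True.prems by (simp add: algebra_simps)
  also have "\<dots> \<le> M * (B + G * Suc k)" using steps_If_True.prems by (intro mult_le_mono) auto
  finally have "cost b m + bits (val b m) \<le> M * (B + G * Suc k)" .
  moreover have "k1 \<le> M * k * (B + G * Suc k)"
    using k1(2) by (rule order_trans) (intro mult_le_mono2 add_left_mono, simp)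
  ultimately have "cost b m + bits (val b m) + k1 \<le> M * Suc k * (B + G * Suc k)"
    by (simp add: algebra_simps)
  moreover have "bounded (B + G * Suc k) m'" using k1(3) by (rule bounded_mono) simp
  ultimately show ?case using run.run_If_True[OF steps_If_True.hyps(1) k1(1)] by blast
next
  case (steps_If_False b m d k m' c)
  obtain k1 where k1: "run d m k1 m'" "k1 \<le> M * k * (B + G * k)" "bounded (B + G * k) m'"
    using steps_If_False.IH[of B] steps_If_False.prems by auto
  have "cost b m + bits (val b m) \<le> (price b + width b) * B"
    using cost_le[of B m b] bits_val_le[of B m b] steps_If_False.prems by (simp add: algebra_simps)
  also have "\<dots> \<le> M * (B + G * Suc k)" using steps_If_False.prems by (intro mult_le_mono) auto
  finally have "cost b m + bits (val b m) \<le> M * (B + G * Suc k)" .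
  moreover have "k1 \<le> M * k * (B + G * Suc k)"
    using k1(2) by (rule order_trans) (intro mult_le_mono2 add_left_mono, simp)
  ultimately have "cost b m + bits (val b m) + k1 \<le> M * Suc k * (B + G * Suc k)"
    by (simp add: algebra_simps)
  moreover have "bounded (B + G * Suc k) m'" using k1(3) by (rule bounded_mono) simp
  ultimately show ?case using run.run_If_False[OF steps_If_False.hyps(1) k1(1)] by blast
next
  case (steps_While_False b m c)
  have "cost b m + bits (val b m) \<le> (price b + width b) * B"
    using cost_le[of B m b] bits_val_le[of B m b] steps_While_False.prems by (simp add: algebra_simps)
  also have "\<dots> \<le> M * 1 * (B + G * 1)" using steps_While_False.prems by (intro mult_le_mono) auto
  finally have "cost b m + bits (val b m) \<le> M * 1 * (B + G * 1)" .
  moreover have "bounded (B + G * 1) m" using steps_While_False.prems(4) by (rule bounded_mono) simp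
  ultimately show ?case using run.run_While_False[OF steps_While_False.hyps(1)] by blast
next
  case (steps_While_True b m c k m' l m'')
  let ?N = "Suc (k + l)"
  obtain k1 where k1: "run c m k1 m'" "k1 \<le> M * k * (B + G * k)" "bounded (B + G * k) m'"
    using steps_While_True.IH(1)[of B] steps_While_True.prems by auto
  obtain k2 where k2: "run (While b c) m' k2 m''" "k2 \<le> M * l * (B + G * k + G * l)"
    "bounded (B + G * k + G * l) m''"
    using steps_While_True.IH(2)[of "B + G * k"] steps_While_True.prems k1 by auto
  have "cost b m + bits (val b m) \<le> (price b + width b) * B"
    using cost_le[of B m b] bits_val_le[of B m b] steps_While_True.prems by (simp add: algebra_simps)
  also have "\<dots> \<le> M * (B + G * ?N)" using steps_While_True.prems by (intro mult_le_mono) auto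
  finally have "cost b m + bits (val b m) \<le> M * (B + G * ?N)" .
  moreover have "k1 \<le> M * k * (B + G * ?N)"
    using k1(2) by (rule order_trans) (intro mult_le_mono2 add_left_mono, simp)
  moreover have "k2 \<le> M * l * (B + G * ?N)"
    using k2(2) by (rule order_trans) (intro mult_le_mono2, simp add: algebra_simps)
  ultimately have "cost b m + bits (val b m) + k1 + k2 \<le> M * ?N * (B + G * ?N)"
    by (simp add: algebra_simps)
  moreover have "bounded (B + G * ?N) m''" using k2(3) by (rule bounded_mono) (simp add: algebra_simps)
  ultimately show ?case
    using run.run_While_True[OF steps_While_True.hyps(1) k1(1) k2(1)] by blast
qed

lemma steps_run:
  assumes "steps c m N m'" "linear c" "bounded B m" "1 \<le> B"
  obtains k where "run c m k m'" "k \<le> fee c * N * (B + growth c * N)"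
  using steps_run_aux[OF assms(1,2) order.refl order.refl assms(3,4)] by blast

section \<open>Total correctness with step budgets\<close>

definition halts :: "com \<Rightarrow> nat \<Rightarrow> (memory \<Rightarrow> bool) \<Rightarrow> memory \<Rightarrow> bool" where
  "halts c N Q m \<longleftrightarrow> (\<exists>k m'. steps c m k m' \<and> k \<le> N \<and> Q m')"

lemma halts_mono:
  "halts c N Q m \<Longrightarrow> N \<le> N' \<Longrightarrow> (\<And>m'. Q m' \<Longrightarrow> Q' m') \<Longrightarrow> halts c N' Q' m"
  unfolding halts_def by (meson order_trans)

lemma halts_weaken: "halts c N Q m \<Longrightarrow> N \<le> N' \<Longrightarrow> halts c N' Q m"
  by (rule halts_mono)

lemma halts_Skip: "Q m \<Longrightarrow> 1 \<le> N \<Longrightarrow> halts Skip N Q m"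
  unfolding halts_def using steps_Skip by blast

lemma halts_Write:
  "Q (m(x := (m x)(val a m := val e m))) \<Longrightarrow> 1 \<le> N \<Longrightarrow> halts (Write x a e) N Q m"
  unfolding halts_def using steps_Write by blast

text \<open>\<open>halts\<close> acts as a weakest precondition with a budget: the postcondition of
  the first program is a \<open>halts\<close> statement about the second, so proofs run through a
  program from left to right.\<close>

lemma halts_Seq:
  "halts c N (halts d N' Q) m \<Longrightarrow> halts (Seq c d) (N + N') Q m"
  unfolding halts_def by (meson steps_Seq add_mono)

lemma halts_Write_Seq:
  "halts c N Q (m(x := (m x)(val a m := val e m))) \<Longrightarrow> halts (Seq (Write x a e) c) (Suc N) Q m"
  using halts_Seq[OF halts_Write, of c N Q m x a e 1] by simp

lemma halts_If:
  "(val b m \<noteq> 0 \<Longrightarrow> halts c N Q m) \<Longrightarrow> (val b m = 0 \<Longrightarrow> halts d N Q m) \<Longrightarrow>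
   halts (If b c d) (Suc N) Q m"
  unfolding halts_def by (meson steps_If_True steps_If_False Suc_le_mono)

lemma halts_While_False: "val b m = 0 \<Longrightarrow> Q m \<Longrightarrow> 1 \<le> N \<Longrightarrow> halts (While b c) N Q m"
  unfolding halts_def using steps_While_False by blast

lemma halts_While_True:
  assumes "val b m \<noteq> 0" "halts c N (halts (While b c) N' Q) m"
  shows "halts (While b c) (Suc (N + N')) Q m"
  using assms unfolding halts_def by (meson steps_While_True Suc_le_mono add_mono)

abbreviation var :: "string \<Rightarrow> exp" where
  "var x \<equiv> Read x (Const 0)"

abbreviation assign :: "string \<Rightarrow> exp \<Rightarrow> com" where
  "assign x e \<equiv> Write x (Const 0) e"

definition countdown :: "string \<Rightarrow> com \<Rightarrow> com" where
  "countdown x c = While (var x) (Seq c (assign x (Bin Sub (var x) (Const 1))))"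

text \<open>The counter runs downwards to 0, so invariants speak of the indices above it as already
  processed. Each round pays for one test, the body and one decrement, and the last failing test
  adds 1.\<close>

lemma halts_countdown:
  assumes body: "\<And>k m. 0 < k \<Longrightarrow> k \<le> n0 \<Longrightarrow> m x 0 = k \<Longrightarrow> Inv k m \<Longrightarrow>
      halts c N (\<lambda>m'. m' x 0 = k \<and> Inv (k - 1) (m'(x := (m' x)(0 := k - 1)))) m"
    and "m x 0 = n" "n \<le> n0" "Inv n m"
  shows "halts (countdown x c) (n * (N + 2) + 1) (Inv 0) m"
  using assms(2-4)
proof (induction n arbitrary: m)
  case 0
  then show ?case unfolding countdown_def by (intro halts_While_False) simp_all
next
  case (Suc n)
  let ?d = "assign x (Bin Sub (var x) (Const 1))"
  have "halts (countdown x c) (Suc (N + 1 + (n * (N + 2) + 1))) (Inv 0) m"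
    unfolding countdown_def
  proof (rule halts_While_True[OF _ halts_Seq])
    show "val (var x) m \<noteq> 0" using Suc.prems by simp
    show "halts c N (halts ?d 1 (halts (While (var x) (Seq c ?d)) (n * (N + 2) + 1) (Inv 0))) m"
    proof (rule halts_mono[OF body[OF _ Suc.prems(2,1,3)] order.refl])
      fix m' assume m': "m' x 0 = Suc n \<and> Inv (Suc n - 1) (m'(x := (m' x)(0 := Suc n - 1)))"
      show "halts ?d 1 (halts (While (var x) (Seq c ?d)) (n * (N + 2) + 1) (Inv 0)) m'"
      proof (rule halts_Write)
        have "halts (countdown x c) (n * (N + 2) + 1) (Inv 0) (m'(x := (m' x)(0 := n)))"
        proof (rule Suc.IH)
          show "Inv n (m'(x := (m' x)(0 := n)))" using m' by (simp only: diff_Suc_1)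
        qed (use Suc.prems in simp_all)
        then show "halts (While (var x) (Seq c ?d)) (n * (N + 2) + 1) (Inv 0)
            (m'(x := (m' x)(val (Const 0) m' := val (Bin Sub (var x) (Const 1)) m')))"
          using m' by (simp add: countdown_def)
      qed simp
    qed simp
  qed
  then show ?case by (simp add: algebra_simps)
qed

definition for_loop :: "string \<Rightarrow> exp \<Rightarrow> com \<Rightarrow> com" where
  "for_loop x e c = Seq (assign x e) (countdown x c)"

text \<open>Made for nesting: each level raises the exponent of \<open>M\<close> by one and the
  coefficient by 4, namely 2 for test and decrement in each round and 2 for the initialisation and
  the last test.\<close>

lemma halts_for_loop:
  assumes body: "\<And>k m. 0 < k \<Longrightarrow> k \<le> n \<Longrightarrow> m x 0 = k \<Longrightarrow> Inv k m \<Longrightarrow>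
      halts c (C * M ^ a) (\<lambda>m'. m' x 0 = k \<and> Inv (k - 1) (m'(x := (m' x)(0 := k - 1)))) m"
    and "val e m = n" "n \<le> M" "1 \<le> M" "Inv n (m(x := (m x)(0 := n)))"
  shows "halts (for_loop x e c) ((C + 4) * M ^ Suc a) (Inv 0) m"
proof -
  have "halts (countdown x c) (n * (C * M ^ a + 2) + 1) (Inv 0)
      (m(x := (m x)(val (Const 0) m := val e m)))"
  proof (rule halts_countdown[where n0 = n and n = n])
    show "halts c (C * M ^ a) (\<lambda>m'. m' x 0 = k \<and> Inv (k - 1) (m'(x := (m' x)(0 := k - 1)))) m"
      if "0 < k" "k \<le> n" "m x 0 = k" "Inv k m" for k m
      using that by (rule body)
    show "Inv n (m(x := (m x)(val (Const 0) m := val e m)))" using assms by (simp only: val.simps)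
  qed (use assms in simp_all)
  then have "halts (for_loop x e c) (Suc (n * (C * M ^ a + 2) + 1)) (Inv 0) m"
    unfolding for_loop_def by (rule halts_Write_Seq)
  moreover have "Suc (n * (C * M ^ a + 2) + 1) \<le> (C + 4) * M ^ Suc a"
  proof -
    have "1 \<le> M ^ a" using \<open>1 \<le> M\<close> by simp
    then have "n * (C * M ^ a + 2) \<le> M * (C * M ^ a + 2 * M ^ a)"
      using \<open>n \<le> M\<close> by (intro mult_le_mono add_mono) auto
    moreover have "1 \<le> M * M ^ a" using \<open>1 \<le> M\<close> \<open>1 \<le> M ^ a\<close> by simp
    ultimately have "Suc (n * (C * M ^ a + 2) + 1) \<le> M * (C * M ^ a + 2 * M ^ a) + 2 * (M * M ^ a)"
      by linarith
    then show ?thesis by (simp add: algebra_simps)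
  qed
  ultimately show ?thesis by (rule halts_weaken)
qed

definition same :: "string set \<Rightarrow> memory \<Rightarrow> memory \<Rightarrow> bool" where
  "same V m m' \<longleftrightarrow> (\<forall>y. y \<notin> V \<longrightarrow> m' y = m y)"

lemma same_refl [simp]: "same V m m"
  by (simp add: same_def)

lemma same_upd [simp]: "x \<in> V \<Longrightarrow> same V m (m'(x := f)) \<longleftrightarrow> same V m m'"
  by (auto simp: same_def)

lemma same_trans: "same V m m' \<Longrightarrow> same V' m' m'' \<Longrightarrow> V \<subseteq> U \<Longrightarrow> V' \<subseteq> U \<Longrightarrow> same U m m''"
  by (simp add: same_def) (metis in_mono)

lemma same_disjoint: "same V m m' \<Longrightarrow> V \<inter> W = {} \<Longrightarrow> y \<in> W \<Longrightarrow> m' y = m y"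
  by (auto simp: same_def)

section \<open>The program\<close>

text \<open>
  The stack occupies cells \<open>1, \<dots>, L\<close> of the arrays \<open>I\<close> (items), \<open>X\<close> (periods), \<open>E\<close> (right ends)
  and \<open>V\<close> (values); cell 1 is a dummy of item 0 with right end and value 0. In tests,
  conjunction is a product, disjunction a sum, and \<open>x \<le> y\<close> reads \<open>y + 1 - x \<noteq> 0\<close>.
\<close>

definition add_conflict :: com where
  "add_conflict =
     If (Bin Add
          (Bin Sub (Bin Add (Read ''E'' (var ''j'')) (Read ''w'' (var ''i''))) (var ''e''))
          (Bin Sub (Const 1)
            (Bin Add (Bin Sub (Read ''I'' (var ''j'')) (var ''i''))
              (Bin Sub (var ''i'') (Read ''I'' (var ''j''))))))
       (assign ''s'' (Bin Add (var ''s'') (Read ''V'' (var ''j''))))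
       Skip"

definition conf_loop :: com where
  "conf_loop = Seq (assign ''s'' (Const 0)) (for_loop ''j'' (var ''L'')
     add_conflict)"

definition profit_exp :: exp where
  "profit_exp = Read ''p'' (Bin Add (Bin Mul (var ''i'') (Bin Add (var ''T'') (Const 1))) (var ''t''))"

definition raise_end :: com where
  "raise_end =
     If (Bin Sub (Read ''E'' (var ''L'')) (var ''e'')) (assign ''e'' (Read ''E'' (var ''L''))) Skip"

definition compare :: com where
  "compare =
     If (Bin Mul
          (Bin Mul
            (Bin Sub (Bin Add (Read ''W'' (var ''t'')) (Const 1)) (var ''e''))
            (Bin Sub profit_exp (var ''s'')))
          (Bin Mul
            (Bin Sub (Bin Add (Bin Mul (var ''q'') (Bin Sub profit_exp (var ''s''))) (Const 1)) profit_exp)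
            (Bin Sub (var ''b'') (var ''e''))))
       (Seq (assign ''b'' (var ''e''))
       (Seq (assign ''bi'' (var ''i''))
       (Seq (assign ''bt'' (var ''t''))
            (assign ''bv'' (Bin Sub profit_exp (var ''s''))))))
       Skip"

definition candidate_step :: com where
  "candidate_step =
     Seq (assign ''e'' (Bin Add (Read ''E'' (var ''k'')) (Read ''w'' (var ''i''))))
    (Seq raise_end
    (Seq conf_loop
      compare))"

text \<open>The last capacity plus 1 exceeds every end that respects a capacity; it serves as
  initial minimum and as the sign that no candidate was found.\<close>

definition search :: com where
  "search =
     Seq (assign ''b'' (Bin Add (Read ''W'' (var ''T'')) (Const 1)))
       (for_loop ''i'' (var ''n'') (for_loop ''t'' (var ''T'') (for_loop ''k'' (var ''L'') candidate_step)))"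

definition push_step :: com where
  "push_step =
     Seq (assign ''L'' (Bin Add (var ''L'') (Const 1)))
    (Seq (Write ''I'' (var ''L'') (var ''bi''))
    (Seq (Write ''X'' (var ''L'') (var ''bt''))
    (Seq (Write ''E'' (var ''L'') (var ''b''))
         (Write ''V'' (var ''L'') (var ''bv'')))))"

definition build :: com where
  "build = While (var ''go'')
     (Seq search
       (If (Bin Sub (Bin Add (Read ''W'' (var ''T'')) (Const 1)) (var ''b''))
         push_step
         (assign ''go'' (Const 0))))"

definition stacked_entry :: "exp \<Rightarrow> exp" where
  "stacked_entry t = Bin Add (Bin Mul (Read ''I'' (var ''k'')) (Bin Add (var ''T'') (Const 1))) t"

definition mark :: com where
  "mark = for_loop ''t'' (var ''T'')
     (If (Bin Sub (Bin Add (var ''t'') (Const 1)) (Read ''X'' (var ''k'')))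
       (Write ''S'' (stacked_entry (var ''t'')) (Const 1))
       Skip)"

text \<open>A selected item is marked in all periods from its insertion to the horizon, so the last
  column tells whether an item is already in use. The item number appears as a factor because it
  vanishes at the dummy, which must not be selected.\<close>

definition select :: com where
  "select = Seq (assign ''lo'' (Read ''E'' (var ''L'')))
     (for_loop ''k'' (var ''L'')
       (If (Bin Mul
             (Bin Mul (Read ''I'' (var ''k''))
               (Bin Sub (Bin Add (var ''lo'') (Const 1)) (Read ''E'' (var ''k''))))
             (Bin Sub (Const 1) (Read ''S'' (stacked_entry (var ''T'')))))
         (Seq (assign ''lo'' (Bin Sub (Read ''E'' (var ''k'')) (Read ''w'' (Read ''I'' (var ''k'')))))
           mark)
         Skip))"

definition main :: com where
  "main = Seq (assign ''L'' (Const 1)) (Seq (assign ''go'' (Const 1)) (Seq build select))"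

text \<open>The accuracy enters only through the constant \<open>Q\<close>; \<open>main\<close>
  reads \<open>q\<close> from memory and is the same program for all accuracies.\<close>

definition program :: "nat \<Rightarrow> com" where
  "program Q = Seq (If (Bin Sub (var ''n'') (Const 1)) (assign ''q'' (Const Q)) (assign ''q'' (Const 2))) main"

lemma linear_main: "linear main"
  by (simp add: main_def build_def select_def mark_def push_step_def search_def candidate_step_def
      conf_loop_def add_conflict_def raise_end_def compare_def for_loop_def countdown_def profit_exp_def)

section \<open>The search for the next interval to push\<close>

definition mem_conf :: "memory \<Rightarrow> nat \<Rightarrow> nat \<Rightarrow> nat" where
  "mem_conf m i e =
     sum (m ''V'') {j \<in> {1..m ''L'' 0}. m ''I'' j = i \<or> e < m ''E'' j + m ''w'' i}"

lemma conf_loop: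
  assumes "m ''L'' 0 \<le> M" "1 \<le> M"
  shows "halts conf_loop (7 * M)
    (\<lambda>m'. same {''s'', ''j''} m m' \<and> m' ''s'' 0 = mem_conf m (m ''i'' 0) (m ''e'' 0)) m"
proof -
  define L i e where "L = m ''L'' 0" and "i = m ''i'' 0" and "e = m ''e'' 0"
  let ?c = "\<lambda>j. m ''I'' j = i \<or> e < m ''E'' j + m ''w'' i"
  define Inv where "Inv k m' \<longleftrightarrow>
    same {''s'', ''j''} m m' \<and> m' ''s'' 0 = sum (m ''V'') {j \<in> {k<..L}. ?c j}" for k m'
  have "halts conf_loop (Suc ((2 + 4) * M ^ Suc 0)) (Inv 0) m"
    unfolding conf_loop_def
  proof (intro halts_Write_Seq halts_for_loop)
    fix k m1 assume k: "0 < k" "k \<le> L" "m1 ''j'' 0 = k" "Inv k m1"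
    have s: "same {''s'', ''j''} m m1" and sum: "m1 ''s'' 0 = sum (m ''V'') {j \<in> {k<..L}. ?c j}"
      using k(4) by (auto simp: Inv_def)
    have [simp]: "m1 ''E'' = m ''E''" "m1 ''I'' = m ''I''" "m1 ''V'' = m ''V''" "m1 ''w'' = m ''w''"
      "m1 ''i'' 0 = i" "m1 ''e'' 0 = e"
      using s by (auto simp: same_def i_def e_def)
    have step: "{j \<in> {k - 1<..L}. ?c j} =
        (if ?c k then insert k {j \<in> {k<..L}. ?c j} else {j \<in> {k<..L}. ?c j})"
      using k by (auto simp: not_less_eq_eq order_le_less_trans) (metis Suc_leI Suc_pred le_neq_implies_less)+
    \<comment> \<open>The two opposite truncated differences add up to the distance of the item
      numbers, so the second summand is 1 for equal items and 0 otherwise.\<close>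
    have test: "(m ''E'' k + m ''w'' i - e) + (1 - ((m ''I'' k - i) + (i - m ''I'' k))) \<noteq> 0 \<longleftrightarrow> ?c k"
      by auto
    have "halts add_conflict (Suc 1)
        (\<lambda>m'. m' ''j'' 0 = k \<and> Inv (k - 1) (m'(''j'' := (m' ''j'')(0 := k - 1)))) m1"
      unfolding add_conflict_def
    proof (rule halts_If, goal_cases)
      case 1
      then have "?c k" using test k by simp
      then show ?case using k s sum step by (intro halts_Write) (simp_all add: Inv_def)
    next
      case 2
      then have "\<not> ?c k" using test k by simp
      then show ?case using k s sum step by (intro halts_Skip) (simp_all add: Inv_def)
    qed
    then show "halts add_conflict (2 * M ^ 0)
        (\<lambda>m'. m' ''j'' 0 = k \<and> Inv (k - 1) (m'(''j'' := (m' ''j'')(0 := k - 1)))) m1"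
      by (rule halts_weaken) simp
  qed (use assms in \<open>simp_all add: L_def Inv_def same_def\<close>)
  then show ?thesis
    by (rule halts_mono)
      (use assms in \<open>auto simp: Inv_def mem_conf_def i_def e_def L_def Suc_le_eq intro!: sum.cong\<close>)
qed

definition mem_profit :: "memory \<Rightarrow> nat \<Rightarrow> nat \<Rightarrow> nat" where
  "mem_profit m i t = m ''p'' (i * (m ''T'' 0 + 1) + t)"

definition mem_end :: "memory \<Rightarrow> nat \<Rightarrow> nat \<Rightarrow> nat" where
  "mem_end m i k = max (m ''E'' (m ''L'' 0)) (m ''E'' k + m ''w'' i)"

definition mem_ok :: "memory \<Rightarrow> nat \<Rightarrow> nat \<Rightarrow> nat \<Rightarrow> bool" where
  "mem_ok m i t e \<longleftrightarrow> e \<le> m ''W'' t \<and> good (m ''q'' 0) (mem_profit m i t) (mem_conf m i e)"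

text \<open>Invariant of the search, with \<open>A\<close> the set of candidates already examined.
  Candidates are evaluated in the initial memory \<open>m\<close>, which is sound because the search
  changes only scratch variables.\<close>

definition best :: "memory \<Rightarrow> (nat \<times> nat \<times> nat) set \<Rightarrow> memory \<Rightarrow> bool" where
  "best m A m' \<longleftrightarrow>
     (\<forall>(i, t, k) \<in> A. mem_ok m i t (mem_end m i k) \<longrightarrow> m' ''b'' 0 \<le> mem_end m i k) \<and>
     (m' ''b'' 0 = m ''W'' (m ''T'' 0) + 1 \<or>
      (\<exists>(i, t, k) \<in> A. mem_ok m i t (mem_end m i k) \<and> m' ''b'' 0 = mem_end m i k \<and>
         m' ''bi'' 0 = i \<and> m' ''bt'' 0 = t \<and>
         m' ''bv'' 0 = mem_profit m i t - mem_conf m i (mem_end m i k)))"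

definition step_vars :: "string set" where
  "step_vars = {''j'', ''s'', ''e'', ''b'', ''bi'', ''bt'', ''bv''}"

definition search_vars :: "string set" where
  "search_vars = {''i'', ''t'', ''k'', ''j'', ''s'', ''e'', ''b'', ''bi'', ''bt'', ''bv''}"

lemma best_cong:
  "m1 ''b'' 0 = m2 ''b'' 0 \<Longrightarrow> m1 ''bi'' 0 = m2 ''bi'' 0 \<Longrightarrow> m1 ''bt'' 0 = m2 ''bt'' 0 \<Longrightarrow>
   m1 ''bv'' 0 = m2 ''bv'' 0 \<Longrightarrow> best m A m1 \<longleftrightarrow> best m A m2"
  by (simp add: best_def)

lemma mem_conf_same: "same search_vars m m' \<Longrightarrow> mem_conf m' = mem_conf m"
  by (intro ext) (simp add: mem_conf_def same_def search_vars_def)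

lemma best_insert_skip:
  assumes "best m A m'" "\<not> (mem_ok m i t (mem_end m i k) \<and> mem_end m i k < m' ''b'' 0)"
  shows "best m (insert (i, t, k) A) m'"
  using assms by (auto simp: best_def)

lemma best_insert_take:
  assumes "best m A m'" "mem_ok m i t (mem_end m i k)" "mem_end m i k < m' ''b'' 0"
    and "m'' ''b'' 0 = mem_end m i k" "m'' ''bi'' 0 = i" "m'' ''bt'' 0 = t"
    "m'' ''bv'' 0 = mem_profit m i t - mem_conf m i (mem_end m i k)"
  shows "best m (insert (i, t, k) A) m''"
  using assms by (fastforce simp: best_def)

lemma candidate_step:
  assumes "m ''L'' 0 \<le> M" "1 \<le> M" and "same search_vars m m1" and best: "best m A m1"
    and pos: "m1 ''i'' 0 = i" "m1 ''t'' 0 = t" "m1 ''k'' 0 = k"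
  shows "halts candidate_step (15 * M)
    (\<lambda>m'. same step_vars m1 m' \<and> best m (insert (i, t, k) A) m') m1"
proof -
  let ?e = "mem_end m i k"
  have [simp]: "m1 ''E'' = m ''E''" "m1 ''w'' = m ''w''" "m1 ''W'' = m ''W''" "m1 ''p'' = m ''p''"
    "m1 ''L'' = m ''L''" "m1 ''T'' = m ''T''" "m1 ''q'' = m ''q''"
    using assms(3) by (auto simp: same_def search_vars_def)
  have "halts candidate_step (Suc (2 + (7 * M + 5)))
    (\<lambda>m'. same step_vars m1 m' \<and> best m (insert (i, t, k) A) m') m1"
    unfolding candidate_step_def
  proof (rule halts_Write_Seq, rule halts_Seq)
    let ?m = "m1(''e'' := (m1 ''e'')(0 := m ''E'' k + m ''w'' i))"
    let ?R = "\<lambda>m'. same {''e''} m1 m' \<and> m' ''e'' 0 = ?e"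
    have "halts raise_end
        (Suc 1) ?R ?m"
      unfolding raise_end_def by (rule halts_If; (rule halts_Write halts_Skip)) (simp_all add: mem_end_def same_def pos)
    then show "halts raise_end
        2 (halts (Seq conf_loop
      compare) (7 * M + 5) (\<lambda>m'. same step_vars m1 m' \<and> best m (insert (i, t, k) A) m'))
      (m1(''e'' := (m1 ''e'')(val (Const 0) m1 := val (Bin Add (Read ''E'' (var ''k'')) (Read ''w'' (var ''i''))) m1)))"
    proof (simp add: pos, rule halts_mono)
      fix m2 assume m2: "?R m2"
      have s2: "same search_vars m m2"
        using assms(3) m2 by (auto simp: same_def search_vars_def)
      have "halts conf_loop (7 * M)
          (\<lambda>m'. same {''s'', ''j''} m2 m' \<and> m' ''s'' 0 = mem_conf m i ?e) m2"
        using conf_loop[of m2 M] m2 assms(1,2) mem_conf_same[OF s2] pos by (simp add: same_def)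
      then show "halts (Seq conf_loop
      compare) (7 * M + 5) (\<lambda>m'. same step_vars m1 m' \<and> best m (insert (i, t, k) A) m') m2"
      proof (rule halts_Seq[OF halts_mono])
        fix m3 assume m3: "same {''s'', ''j''} m2 m3 \<and> m3 ''s'' 0 = mem_conf m i ?e"
        have s3: "same {''e'', ''s'', ''j''} m1 m3" using m2 m3 by (auto simp: same_def)
        have [simp]: "m3 ''W'' = m ''W''" "m3 ''q'' = m ''q''" "m3 ''e'' 0 = ?e"
          "m3 ''s'' 0 = mem_conf m i ?e" "m3 ''i'' 0 = i" "m3 ''t'' 0 = t" "m3 ''b'' = m1 ''b''"
          "val profit_exp m3 = mem_profit m i t"
          using s3 m3 m2 pos by (auto simp: same_def profit_exp_def mem_profit_def)
        have b3: "best m A m3" using best s3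
          by (subst best_cong[of m3 m1]) (auto simp: same_def)
        have upd: "val profit_exp (m3(''b'' := f, ''bi'' := g, ''bt'' := h)) = val profit_exp m3" for f g h
          by (simp add: profit_exp_def)
        have test: "(m ''W'' t + 1 - ?e) * (mem_profit m i t - mem_conf m i ?e) *
            ((m ''q'' 0 * (mem_profit m i t - mem_conf m i ?e) + 1 - mem_profit m i t) * (m1 ''b'' 0 - ?e)) \<noteq> 0
            \<longleftrightarrow> mem_ok m i t ?e \<and> ?e < m1 ''b'' 0"
          by (auto simp: mem_ok_def good_def)
        have "halts compare (Suc (Suc (Suc (Suc 1)))) (\<lambda>m'. same step_vars m1 m' \<and> best m (insert (i, t, k) A) m') m3"
          unfolding compare_def
        proof (rule halts_If, goal_cases)
          case 1
          then have ok: "mem_ok m i t ?e" "?e < m3 ''b'' 0" using test by simp_all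
          show ?case
            by (intro halts_Write_Seq halts_Write conjI best_insert_take[OF b3 ok])
              (use s3 pos in \<open>simp_all add: same_def step_vars_def upd\<close>)
        next
          case 2
          then have "\<not> (mem_ok m i t ?e \<and> ?e < m3 ''b'' 0)" using test by simp
          then show ?case using s3 best_insert_skip[OF b3]
            by (intro halts_Skip) (auto simp add: same_def step_vars_def)
        qed
        then show "halts compare 5 (\<lambda>m'. same step_vars m1 m' \<and> best m (insert (i, t, k) A) m') m3"
          by (simp add: numeral_eq_Suc)
      qed simp
    qed simp_all
  qed
  then show ?thesis using assms(2) by (auto intro: halts_weaken)
qed

lemma search_loops:
  assumes "m ''L'' 0 = L" "m ''T'' 0 = T" "m ''n'' 0 = n"
    and "L \<le> M" "T \<le> M" "n \<le> M" "1 \<le> M"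
  shows "halts search (28 * M ^ 4) (\<lambda>m'. same search_vars m m' \<and>
    best m ({1..n} \<times> {1..T} \<times> {1..L}) m') m"
proof -
  \<comment> \<open>Stated for an arbitrary set \<open>A\<close> of candidates already examined, so
    that the loop can be used inside the outer ones with whatever they have covered so far.\<close>
  have k_loop: "halts (for_loop ''k'' (var ''L'') candidate_step) (19 * M ^ 2)
      (\<lambda>m'. same (insert ''k'' step_vars) m1 m' \<and> best m (A \<union> {i} \<times> {t} \<times> {1..L}) m') m1"
    if m1: "same search_vars m m1" "best m A m1" "m1 ''i'' 0 = i" "m1 ''t'' 0 = t" for m1 A i t
  proof -
    define Inv where "Inv k m' \<longleftrightarrow> same (insert ''k'' step_vars) m1 m' \<and>
      best m (A \<union> {i} \<times> {t} \<times> {k<..L}) m'" for k m'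
    have "halts (for_loop ''k'' (var ''L'') candidate_step) ((15 + 4) * M ^ Suc 1) (Inv 0) m1"
    proof (rule halts_for_loop)
      fix k m2 assume k: "0 < k" "k \<le> L" "m2 ''k'' 0 = k" "Inv k m2"
      then have s2: "same (insert ''k'' step_vars) m1 m2" by (simp add: Inv_def)
      have "same search_vars m m2" using m1(1) s2
        by (rule same_trans) (auto simp: search_vars_def step_vars_def)
      moreover have "m2 ''i'' 0 = i" "m2 ''t'' 0 = t"
        using s2 m1 by (auto simp: same_def step_vars_def)
      ultimately have "halts candidate_step (15 * M) (\<lambda>m'. same step_vars m2 m' \<and>
          best m (insert (i, t, k) (A \<union> {i} \<times> {t} \<times> {k<..L})) m') m2"
        using k assms by (intro candidate_step) (auto simp: Inv_def)
      then show "halts candidate_step (15 * M ^ 1)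
          (\<lambda>m'. m' ''k'' 0 = k \<and> Inv (k - 1) (m'(''k'' := (m' ''k'')(0 := k - 1)))) m2"
      proof (rule halts_mono)
        fix m3 assume m3: "same step_vars m2 m3 \<and>
          best m (insert (i, t, k) (A \<union> {i} \<times> {t} \<times> {k<..L})) m3"
        have "insert (i, t, k) (A \<union> {i} \<times> {t} \<times> {k<..L}) = A \<union> {i} \<times> {t} \<times> {k - 1<..L}"
          using k by auto
        with m3 have "best m (A \<union> {i} \<times> {t} \<times> {k - 1<..L}) m3" by simp
        moreover have "m3 ''k'' 0 = k" using m3 k by (simp add: same_def step_vars_def)
        moreover have "same (insert ''k'' step_vars) m1 m3" using s2 conjunct1[OF m3]
          by (rule same_trans) auto
        ultimately show "m3 ''k'' 0 = k \<and> Inv (k - 1) (m3(''k'' := (m3 ''k'')(0 := k - 1)))"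
          by (simp add: Inv_def best_def)
      qed simp
    next
      show "Inv L (m1(''k'' := (m1 ''k'')(0 := L)))"
        using m1 by (simp add: Inv_def best_def)
    qed (use assms m1 in \<open>simp_all add: same_def search_vars_def\<close>)
    then show ?thesis
      by (rule halts_mono) (auto simp: Inv_def numeral_2_eq_2 atLeastSucAtMost_greaterThanAtMost[symmetric])
  qed
  have t_loop: "halts (for_loop ''t'' (var ''T'') (for_loop ''k'' (var ''L'') candidate_step)) (23 * M ^ 3)
      (\<lambda>m'. same (insert ''t'' (insert ''k'' step_vars)) m1 m' \<and>
        best m (A \<union> {i} \<times> {1..T} \<times> {1..L}) m') m1"
    if m1: "same search_vars m m1" "best m A m1" "m1 ''i'' 0 = i" for m1 A i
  proof -
    define Inv where "Inv t m' \<longleftrightarrow> same (insert ''t'' (insert ''k'' step_vars)) m1 m' \<and>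
      best m (A \<union> {i} \<times> {t<..T} \<times> {1..L}) m'" for t m'
    have "halts (for_loop ''t'' (var ''T'') (for_loop ''k'' (var ''L'') candidate_step))
        ((19 + 4) * M ^ Suc 2) (Inv 0) m1"
    proof (rule halts_for_loop)
      fix t m2 assume t: "0 < t" "t \<le> T" "m2 ''t'' 0 = t" "Inv t m2"
      then have s2: "same (insert ''t'' (insert ''k'' step_vars)) m1 m2" by (simp add: Inv_def)
      have "same search_vars m m2" using m1(1) s2
        by (rule same_trans) (auto simp: search_vars_def step_vars_def)
      moreover have "m2 ''i'' 0 = i" using s2 m1 by (auto simp: same_def step_vars_def)
      ultimately have "halts (for_loop ''k'' (var ''L'') candidate_step) (19 * M ^ 2)
          (\<lambda>m'. same (insert ''k'' step_vars) m2 m' \<and>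
            best m (A \<union> {i} \<times> {t<..T} \<times> {1..L} \<union> {i} \<times> {t} \<times> {1..L}) m') m2"
        using t by (intro k_loop) (auto simp: Inv_def)
      then show "halts (for_loop ''k'' (var ''L'') candidate_step) (19 * M ^ 2)
          (\<lambda>m'. m' ''t'' 0 = t \<and> Inv (t - 1) (m'(''t'' := (m' ''t'')(0 := t - 1)))) m2"
      proof (rule halts_mono)
        fix m3 assume m3: "same (insert ''k'' step_vars) m2 m3 \<and>
          best m (A \<union> {i} \<times> {t<..T} \<times> {1..L} \<union> {i} \<times> {t} \<times> {1..L}) m3"
        have "A \<union> {i} \<times> {t<..T} \<times> {1..L} \<union> {i} \<times> {t} \<times> {1..L} = A \<union> {i} \<times> {t - 1<..T} \<times> {1..L}"
          using t by auto
        with m3 have "best m (A \<union> {i} \<times> {t - 1<..T} \<times> {1..L}) m3" by simp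
        moreover have "m3 ''t'' 0 = t" using m3 t by (simp add: same_def step_vars_def)
        moreover have "same (insert ''t'' (insert ''k'' step_vars)) m1 m3" using s2 conjunct1[OF m3]
          by (rule same_trans) auto
        ultimately show "m3 ''t'' 0 = t \<and> Inv (t - 1) (m3(''t'' := (m3 ''t'')(0 := t - 1)))"
          by (simp add: Inv_def best_def)
      qed simp
    next
      show "Inv T (m1(''t'' := (m1 ''t'')(0 := T)))"
        using m1 by (simp add: Inv_def best_def)
    qed (use assms m1 in \<open>simp_all add: same_def search_vars_def\<close>)
    then show ?thesis
      by (rule halts_mono) (auto simp: Inv_def numeral_eq_Suc atLeastSucAtMost_greaterThanAtMost[symmetric])
  qed
  define Inv where "Inv i m' \<longleftrightarrow> same search_vars m m' \<and>
    best m ({i<..n} \<times> {1..T} \<times> {1..L}) m'" for i m'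
  have i_loop: "halts (for_loop ''i'' (var ''n'') (for_loop ''t'' (var ''T'') (for_loop ''k'' (var ''L'') candidate_step)))
      ((23 + 4) * M ^ Suc 3) (Inv 0) m1"
    if m1: "same search_vars m m1" "best m {} m1" for m1
  proof (rule halts_for_loop)
    fix i m2 assume i: "0 < i" "i \<le> n" "m2 ''i'' 0 = i" "Inv i m2"
    then have s2: "same search_vars m m2" by (simp add: Inv_def)
    then have "halts (for_loop ''t'' (var ''T'') (for_loop ''k'' (var ''L'') candidate_step)) (23 * M ^ 3)
        (\<lambda>m'. same (insert ''t'' (insert ''k'' step_vars)) m2 m' \<and>
          best m ({i<..n} \<times> {1..T} \<times> {1..L} \<union> {i} \<times> {1..T} \<times> {1..L}) m') m2"
      using i by (intro t_loop) (auto simp: Inv_def)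
    then show "halts (for_loop ''t'' (var ''T'') (for_loop ''k'' (var ''L'') candidate_step)) (23 * M ^ 3)
        (\<lambda>m'. m' ''i'' 0 = i \<and> Inv (i - 1) (m'(''i'' := (m' ''i'')(0 := i - 1)))) m2"
    proof (rule halts_mono)
      fix m3 assume m3: "same (insert ''t'' (insert ''k'' step_vars)) m2 m3 \<and>
        best m ({i<..n} \<times> {1..T} \<times> {1..L} \<union> {i} \<times> {1..T} \<times> {1..L}) m3"
      have "{i<..n} \<times> {1..T} \<times> {1..L} \<union> {i} \<times> {1..T} \<times> {1..L} = {i - 1<..n} \<times> {1..T} \<times> {1..L}"
        using i by auto
      with m3 have "best m ({i - 1<..n} \<times> {1..T} \<times> {1..L}) m3" by simp
      moreover have "m3 ''i'' 0 = i" using m3 i by (simp add: same_def step_vars_def)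
      moreover have "same search_vars m m3" using s2 conjunct1[OF m3]
        by (rule same_trans) (auto simp: search_vars_def step_vars_def)
      ultimately show "m3 ''i'' 0 = i \<and> Inv (i - 1) (m3(''i'' := (m3 ''i'')(0 := i - 1)))"
        by (simp add: Inv_def best_def search_vars_def)
    qed simp
  next
    show "Inv n (m1(''i'' := (m1 ''i'')(0 := n)))"
      using m1 by (simp add: Inv_def best_def search_vars_def)
  qed (use assms m1 in \<open>simp_all add: same_def search_vars_def\<close>)
  have "halts search (Suc ((23 + 4) * M ^ Suc 3)) (Inv 0) m"
    unfolding search_def
  proof (rule halts_Write_Seq, rule i_loop)
    show "same search_vars m (m(''b'' := (m ''b'')(val (Const 0) m := val (Bin Add (Read ''W'' (var ''T'')) (Const 1)) m)))"
      by (simp add: search_vars_def)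
  qed (simp add: best_def)
  then show ?thesis
  proof (rule halts_mono)
    have "1 \<le> M ^ 4" using assms by simp
    then show "Suc ((23 + 4) * M ^ Suc 3) \<le> 28 * M ^ 4" by (simp add: numeral_eq_Suc)
  qed (auto simp: Inv_def atLeastSucAtMost_greaterThanAtMost[symmetric])
qed

section \<open>Correctness of the program\<close>

definition input_at :: "gik \<Rightarrow> memory \<Rightarrow> bool" where
  "input_at I m \<longleftrightarrow> (\<forall>y \<in> {''n'', ''T'', ''w'', ''W'', ''p''}. m y = input_memory I y)"

lemma input_atD:
  assumes "input_at I m"
  shows "m ''n'' 0 = n_items I" "m ''T'' 0 = horizon I"
    "i \<in> items I \<Longrightarrow> m ''w'' i = weight I i"
    "t \<in> periods I \<Longrightarrow> m ''W'' t = capacity I t"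
    "i \<in> items I \<Longrightarrow> t \<in> periods I \<Longrightarrow> mem_profit m i t = profit I i t"
proof -
  have [simp]: "m ''n'' = input_memory I ''n''" "m ''T'' = input_memory I ''T''"
    "m ''w'' = input_memory I ''w''" "m ''W'' = input_memory I ''W''" "m ''p'' = input_memory I ''p''"
    using assms by (auto simp: input_at_def)
  show T: "m ''T'' 0 = horizon I" by (simp add: input_memory_def)
  show "m ''n'' 0 = n_items I" "i \<in> items I \<Longrightarrow> m ''w'' i = weight I i"
    "t \<in> periods I \<Longrightarrow> m ''W'' t = capacity I t"
    by (simp_all add: input_memory_def)
  show "mem_profit m i t = profit I i t" if "i \<in> items I" "t \<in> periods I"
    using input_memory_profit[OF that] T unfolding mem_profit_def entry_def by simp
qed

definition stack_at :: "gik \<Rightarrow> nat \<Rightarrow> memory \<Rightarrow> bool" where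
  "stack_at I q m \<longleftrightarrow> input_at I m \<and> m ''q'' 0 = q \<and>
     gik_stack I q (m ''L'' 0) (m ''I'') (m ''X'') (m ''E'') (m ''V'') \<and> m ''S'' = (\<lambda>_. 0)"

lemma stack_at_same:
  assumes "stack_at I q m" "same V m m'"
    "V \<inter> {''n'', ''T'', ''w'', ''W'', ''p'', ''q'', ''L'', ''I'', ''X'', ''E'', ''V'', ''S''} = {}"
  shows "stack_at I q m'"
proof -
  note eq = same_disjoint[OF assms(2,3)]
  show ?thesis using assms(1) by (simp add: stack_at_def input_at_def eq)
qed

lemma mem_conf_eq:
  assumes "stack_at I q m" "i \<in> items I"
  shows "mem_conf m i e = conf I (m ''I'') (m ''E'') (m ''V'') (m ''L'' 0) i e"
  using assms input_atD(3)[of I m i] by (simp add: mem_conf_def conf_def stack_at_def)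

lemma mem_end_eq:
  assumes "stack_at I q m" "i \<in> items I"
  shows "mem_end m i k = max (m ''E'' (m ''L'' 0)) (m ''E'' k + weight I i)"
  using assms input_atD(3)[of I m i] by (simp add: mem_end_def stack_at_def)

lemma mem_ok_eq:
  assumes "stack_at I q m" "i \<in> items I" "t \<in> periods I"
  shows "mem_ok m i t e \<longleftrightarrow> gik_stack.ok I q (m ''L'' 0) (m ''I'') (m ''E'') (m ''V'') i t e"
proof -
  interpret gik_stack I q "m ''L'' 0" "m ''I''" "m ''X''" "m ''E''" "m ''V''"
    using assms by (simp add: stack_at_def)
  show ?thesis using assms input_atD(4,5)[of I m] mem_conf_eq[OF assms(1,2)]
    by (simp add: mem_ok_def ok_def stack_at_def)
qed

definition saturated :: "gik \<Rightarrow> memory \<Rightarrow> bool" where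
  "saturated I m \<longleftrightarrow> (\<forall>i\<in>items I. \<forall>t\<in>periods I. \<forall>k\<in>{1..m ''L'' 0}. \<not> mem_ok m i t (mem_end m i k))"

lemma saturated_same:
  assumes "saturated I m" "same V m m'"
    "V \<inter> {''T'', ''w'', ''W'', ''p'', ''q'', ''L'', ''I'', ''E'', ''V''} = {}"
  shows "saturated I m'"
proof -
  have "mem_conf m' = mem_conf m" "mem_end m' = mem_end m" "mem_ok m' = mem_ok m" "m' ''L'' = m ''L''"
  proof -
    note eq = same_disjoint[OF assms(2,3)]
    show "mem_conf m' = mem_conf m" by (intro ext) (simp add: mem_conf_def eq)
    show "mem_end m' = mem_end m" by (intro ext) (simp add: mem_end_def eq)
    show "mem_ok m' = mem_ok m" by (intro ext) (simp add: mem_ok_def mem_profit_def mem_conf_def eq)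
    show "m' ''L'' = m ''L''" by (simp add: eq)
  qed
  then show ?thesis using assms(1) by (simp add: saturated_def)
qed

definition push_or_stop :: com where
  "push_or_stop =
     If (Bin Sub (Bin Add (Read ''W'' (var ''T'')) (Const 1)) (var ''b'')) push_step (assign ''go'' (Const 0))"

text \<open>After the search, \<open>b\<close> is at most every acceptable candidate end. If it lies
  within the last capacity, it is attained by the stored candidate, and writing that one is an
  instance of \<open>push\<close>; otherwise no candidate is acceptable.\<close>

lemma build_step:
  assumes st: "stack_at I q m" and L: "m ''L'' 0 = L" and go: "m ''go'' 0 \<noteq> 0"
    and M: "L \<le> M" "n_items I \<le> M" "horizon I \<le> M" "1 \<le> M"
  shows "halts (Seq search push_or_stop) (34 * M ^ 4)
    (\<lambda>m'. stack_at I q m' \<and> (m' ''go'' 0 \<noteq> 0 \<and> m' ''L'' 0 = Suc L \<or> m' ''go'' 0 = 0 \<and> saturated I m')) m"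
    (is "halts _ _ ?Q m")
proof -
  interpret gik_stack I q L "m ''I''" "m ''X''" "m ''E''" "m ''V''"
    using st L by (simp add: stack_at_def)
  have inp: "input_at I m" using st by (simp add: stack_at_def)
  have hor: "horizon I \<in> periods I" using inst by (simp add: gik_instance_def periods_def)
  let ?A = "{1..n_items I} \<times> {1..horizon I} \<times> {1..L}"
  have search: "halts search (28 * M ^ 4) (\<lambda>m'. same search_vars m m' \<and> best m ?A m') m"
    using L M input_atD[OF inp] by (intro search_loops) auto
  have rest: "halts push_or_stop (Suc (Suc (Suc (Suc (Suc 1))))) ?Q m1"
    if m1: "same search_vars m m1" and best: "best m ?A m1" for m1
  proof -
    have st1: "stack_at I q m1"
      using st m1 by (rule stack_at_same) (simp add: search_vars_def)
    have [simp]: "m1 ''L'' 0 = L" "m1 ''T'' 0 = horizon I" "m1 ''go'' = m ''go''" "m1 ''W'' = m ''W''"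
      "m1 ''I'' = m ''I''" "m1 ''X'' = m ''X''" "m1 ''E'' = m ''E''" "m1 ''V'' = m ''V''"
      using m1 L input_atD[OF inp] by (auto simp: same_def search_vars_def)
    have capT: "m ''W'' (horizon I) = capacity I (horizon I)" using input_atD(4)[OF inp hor] .
    have b_le: "m1 ''b'' 0 \<le> max (m ''E'' L) (m ''E'' k + weight I i)"
      if "i \<in> items I" "t \<in> periods I" "k \<in> {1..L}"
        "ok i t (max (m ''E'' L) (m ''E'' k + weight I i))" for i t k
    proof -
      have "(i, t, k) \<in> ?A" using that by (simp add: items_def periods_def)
      then have "mem_ok m i t (mem_end m i k) \<longrightarrow> m1 ''b'' 0 \<le> mem_end m i k"
        using best unfolding best_def by blast
      then show ?thesis
        using mem_ok_eq[OF st that(1,2)] mem_end_eq[OF st that(1)] that(4) L by simp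
    qed
    show ?thesis unfolding push_or_stop_def
    proof (rule halts_If, goal_cases)
      case 1
      then have "m1 ''b'' 0 \<noteq> m ''W'' (m ''T'' 0) + 1" using input_atD(2)[OF inp] by simp
      then obtain i t k where it: "(i, t, k) \<in> ?A" "mem_ok m i t (mem_end m i k)"
        "m1 ''b'' 0 = mem_end m i k" "m1 ''bi'' 0 = i" "m1 ''bt'' 0 = t"
        "m1 ''bv'' 0 = mem_profit m i t - mem_conf m i (mem_end m i k)"
        using best unfolding best_def by blast
      have mem: "i \<in> items I" "t \<in> periods I" "k \<in> {1..L}"
        using it(1) by (auto simp: items_def periods_def)
      let ?b = "m1 ''b'' 0"
      have b: "?b = max (m ''E'' L) (m ''E'' k + weight I i)" "ok i t ?b"
        using it(2,3) mem_ok_eq[OF st mem(1,2)] mem_end_eq[OF st mem(1)] L by simp_all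
      have v: "m1 ''bv'' 0 = profit I i t - conf I (m ''I'') (m ''E'') (m ''V'') L i ?b"
        using it(3,6) mem_conf_eq[OF st mem(1)] input_atD(5)[OF inp mem(1,2)] L by simp
      have "gik_stack I q (Suc L) ((m ''I'')(Suc L := i)) ((m ''X'')(Suc L := t))
          ((m ''E'')(Suc L := ?b)) ((m ''V'')(Suc L := m1 ''bv'' 0))"
        unfolding v by (rule push[OF b_le mem b])
      then show ?case unfolding push_step_def
        using st1 go it(4,5)
        by (intro halts_Write_Seq halts_Write) (simp_all add: stack_at_def input_at_def)
    next
      case 2
      \<comment> \<open>An acceptable candidate would force \<open>b\<close> below the capacity of
        its period, hence below the last capacity, against the failed test.\<close>
      have "\<not> mem_ok m i t (mem_end m i k)" if "i \<in> items I" "t \<in> periods I" "k \<in> {1..L}" for i t k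
      proof
        assume "mem_ok m i t (mem_end m i k)"
        then have ok: "ok i t (max (m ''E'' L) (m ''E'' k + weight I i))"
          using mem_ok_eq[OF st that(1,2)] mem_end_eq[OF st that(1)] L by simp
        from b_le[OF that ok] ok have "m1 ''b'' 0 \<le> capacity I t"
          unfolding ok_def by linarith
        also have "\<dots> \<le> capacity I (horizon I)"
          using inst that(2) hor by (auto simp: gik_instance_def periods_def)
        finally show False using 2 capT by simp
      qed
      then have "saturated I m" using L by (simp add: saturated_def)
      then have "saturated I (m1(''go'' := (m1 ''go'')(0 := 0)))"
      proof (rule saturated_same)
        show "same (insert ''go'' search_vars) m (m1(''go'' := (m1 ''go'')(0 := 0)))"
          using m1 by (simp add: same_def)
      qed (simp add: search_vars_def)
      then show ?case using st1
        by (intro halts_Write) (simp_all add: stack_at_def input_at_def)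
    qed
  qed
  have "halts (Seq search push_or_stop) (28 * M ^ 4 + Suc (Suc (Suc (Suc (Suc 1))))) ?Q m"
    by (rule halts_Seq, rule halts_mono[OF search order.refl], rule rest) auto
  then show ?thesis
  proof (rule halts_weaken)
    have "28 * x + Suc (Suc (Suc (Suc (Suc 1)))) \<le> 34 * x" if "1 \<le> x" for x :: nat
      using that by simp
    then show "28 * M ^ 4 + Suc (Suc (Suc (Suc (Suc 1)))) \<le> 34 * M ^ 4"
      using M by simp
  qed
qed

text \<open>Every push raises the stack, and the invariant alone bounds its height by
  \<open>M\<close>; hence \<open>M\<close> minus the height is a termination measure. In the
  induction, the summand \<open>?N + 2\<close> pays for the last round, which finds nothing, with
  the tests before and after it.\<close>

lemma build:
  assumes "stack_at I q m" "m ''go'' 0 \<noteq> 0" and q: "1 \<le> q"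
    and M: "M = 1 + n_items I * horizon I * q"
  shows "halts build (36 * M ^ 5) (\<lambda>m'. stack_at I q m' \<and> saturated I m') m"
    (is "halts _ _ ?Q m")
proof -
  let ?N = "34 * M ^ 4"
  have L_le: "m ''L'' 0 \<le> M" if "stack_at I q m" for m
    using that gik_stack.L_bound M by (auto simp: stack_at_def)
  have "n_items I \<noteq> 0" "horizon I \<noteq> 0"
    using assms(1) by (auto simp: stack_at_def gik_stack_def gik_instance_def)
  then have le: "n_items I \<le> M" "horizon I \<le> M" "2 \<le> M" using q M
    by (auto simp: Suc_le_eq intro!: le_SucI)
  have build_eq: "build = While (var ''go'') (Seq search push_or_stop)"
    by (simp add: build_def push_or_stop_def)
  have "halts build ((M - m ''L'' 0) * (?N + 1) + (?N + 2)) ?Q m"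
    using assms(1,2)
  proof (induction "M - m ''L'' 0" arbitrary: m rule: less_induct)
    case (less m)
    have "halts build (Suc (?N + ((M - m ''L'' 0) * (?N + 1) + 1))) ?Q m"
      unfolding build_eq
    proof (rule halts_While_True)
      show "val (var ''go'') m \<noteq> 0" using less.prems by simp
      show "halts (Seq search push_or_stop) ?N (halts (While (var ''go'') (Seq search push_or_stop))
          ((M - m ''L'' 0) * (?N + 1) + 1) ?Q) m"
      proof (rule halts_mono[OF build_step[OF less.prems(1) refl less.prems(2)] order.refl])
        fix m1 assume m1: "stack_at I q m1 \<and> (m1 ''go'' 0 \<noteq> 0 \<and> m1 ''L'' 0 = Suc (m ''L'' 0) \<or>
            m1 ''go'' 0 = 0 \<and> saturated I m1)"
        show "halts (While (var ''go'') (Seq search push_or_stop)) ((M - m ''L'' 0) * (?N + 1) + 1) ?Q m1"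
        proof (cases "m1 ''go'' 0 = 0")
          case True
          with m1 show ?thesis by (intro halts_While_False) auto
        next
          case False
          with m1 have L1: "m1 ''L'' 0 = Suc (m ''L'' 0)" "stack_at I q m1" by auto
          then have "Suc (m ''L'' 0) \<le> M" using L_le[of m1] by simp
          then have *: "M - m ''L'' 0 = Suc (M - m1 ''L'' 0)" using L1 by simp
          then have "halts build ((M - m1 ''L'' 0) * (?N + 1) + (?N + 2)) ?Q m1"
            using False L1 by (intro less.hyps) auto
          then show ?thesis unfolding build_eq * by (rule halts_weaken) simp
        qed
      qed (use le L_le less.prems in auto)
    qed
    then show ?case by (rule halts_weaken) simp
  qed
  then show ?thesis
  proof (rule halts_weaken)
    have "1 \<le> m ''L'' 0" using assms(1) by (auto simp: stack_at_def gik_stack_def)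
    then have "(M - m ''L'' 0) * (?N + 1) + (?N + 2) \<le> (M - 1) * (?N + 1) + (?N + 2)"
      by (intro add_mono mult_le_mono) auto
    also have "\<dots> = M * (?N + 1) + 1"
      using le(3) by (cases M) auto
    also have "\<dots> \<le> 36 * M ^ 5"
    proof -
      have "M * M ^ 4 = M ^ 5" by (simp add: numeral_eq_Suc)
      moreover have "M * 1 \<le> M * M ^ 4" using le(3) by (intro mult_le_mono2) simp
      ultimately show ?thesis using le(3) by (simp add: algebra_simps)
    qed
    finally show "(M - m ''L'' 0) * (?N + 1) + (?N + 2) \<le> 36 * M ^ 5" .
  qed
qed

text \<open>
  The greedy pass runs down the stack: \<open>R\<close> is the current selection among the entries above \<open>k0\<close>,
  and \<open>lo\<close> is the left end of the last selected interval.
\<close>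

definition (in gik_stack) pass :: "nat \<Rightarrow> nat set \<Rightarrow> nat \<Rightarrow> bool" where
  "pass k0 R lo \<longleftrightarrow> selection R \<and> R \<subseteq> {k0<..L} \<and>
     (\<forall>k\<in>{2..L} - R. k0 < k \<longrightarrow>
        (\<exists>k'\<in>R. k < k' \<and> (It k = It k' \<or> En k' < En k + weight I (It k')))) \<and>
     (R = {} \<and> lo = En L \<or> (\<exists>k\<in>R. lo = En k - weight I (It k))) \<and>
     (\<forall>k\<in>R. lo \<le> En k - weight I (It k))"

context gik_stack
begin

lemma pass_init: "pass L {} (En L)"
  by (auto simp: pass_def selection_def)

text \<open>Apart from the dummy, a skipped entry shares its item with a selected one or overlaps
  the selected interval whose left end is \<open>lo\<close>. Either way there is the later
  conflicting entry that \<open>selection_profit_ge\<close> asks for.\<close>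

lemma pass_skip:
  assumes "pass k R lo" "0 < k" "k \<le> L" "k = 1 \<or> lo < En k \<or> It k \<in> It ` R"
  shows "pass (k - 1) R lo"
proof -
  have R: "R \<subseteq> {k<..L}" "R \<subseteq> {2..L}" using assms(1) by (auto simp: pass_def selection_def)
  have "\<exists>k'\<in>R. k < k' \<and> (It k = It k' \<or> En k' < En k + weight I (It k'))" if "2 \<le> k"
  proof (cases "It k \<in> It ` R")
    case True
    then obtain k' where "k' \<in> R" "It k = It k'" by auto
    then show ?thesis using R by (intro bexI[of _ k']) auto
  next
    case False
    then have lo: "lo < En k" using assms(4) that by auto
    have "En k \<le> En L" using assms by (intro En_mono) auto
    \<comment> \<open>The initial value of \<open>lo\<close> excludes nothing, because no end
      exceeds the top one; hence \<open>lo\<close> is the left end of a selected interval.\<close>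
    with lo have "lo \<noteq> En L" by simp
    then obtain k' where "k' \<in> R" "lo = En k' - weight I (It k')"
      using assms(1) by (auto simp: pass_def)
    with lo R show ?thesis by (intro bexI[of _ k']) auto
  qed
  then have "\<exists>k'\<in>R. l < k' \<and> (It l = It k' \<or> En k' < En l + weight I (It k'))"
    if "l \<in> {2..L} - R" "k - 1 < l" for l
    using that assms(1,2) by (cases "l = k") (auto simp: pass_def)
  moreover have "{k<..L} \<subseteq> {k - 1<..L}" by auto
  ultimately show ?thesis using assms(1) unfolding pass_def by (intro conjI) (blast+)
qed

text \<open>\<open>lo\<close> is a lower bound for all left ends selected so far, so comparing with
  it alone separates the new interval from every selected one.\<close>

lemma pass_take:
  assumes "pass k R lo" "k \<in> {2..L}" "En k \<le> lo" "It k \<notin> It ` R"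
  shows "pass (k - 1) (insert k R) (En k - weight I (It k))"
proof -
  have R: "R \<subseteq> {k<..L}" "selection R" "\<And>k'. k' \<in> R \<Longrightarrow> lo \<le> En k' - weight I (It k')"
    using assms(1) by (auto simp: pass_def)
  have le: "En k + weight I (It k') \<le> En k'" if "k' \<in> R" for k'
  proof -
    \<comment> \<open>This makes the truncated difference in the left end exact.\<close>
    have "weight I (It k') \<le> En k'"
      using R(2) that by (intro weight_le_En) (auto simp: selection_def)
    then show ?thesis using R(3)[OF that] assms(3) by linarith
  qed
  have "selection (insert k R)"
    unfolding selection_def
  proof (intro conjI ballI impI)
    show "insert k R \<subseteq> {2..L}" using R assms(2) by (auto simp: selection_def)
    show "inj_on It (insert k R)" using R assms(4) by (auto simp: selection_def)
    fix l l' assume "l \<in> insert k R" "l' \<in> insert k R" "l < l'"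
    then show "En l + weight I (It l') \<le> En l'"
      using R le by (auto simp: selection_def)
  qed
  moreover have "En k - weight I (It k) \<le> En l - weight I (It l)" if "l \<in> insert k R" for l
    using that le[of l] by auto
  moreover have "\<exists>k'\<in>insert k R. l < k' \<and> (It l = It k' \<or> En k' < En l + weight I (It k'))"
    if "l \<in> {2..L} - insert k R" "k - 1 < l" for l
  proof -
    have "l \<in> {2..L} - R" "k < l" using that assms(2) by auto
    then show ?thesis using assms(1) by (auto simp: pass_def)
  qed
  moreover have "insert k {k<..L} \<subseteq> {k - 1<..L}" using assms(2) by auto
  ultimately show ?thesis using R(1) unfolding pass_def by (intro conjI) (blast+)
qed

end

section \<open>The greedy pass on the machine and the correctness of \<open>main\<close>\<close>

lemma mark:
  assumes "m ''T'' 0 = H" "H \<le> M" "1 \<le> M"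
  shows "halts mark (6 * M) (\<lambda>m'. same {''t'', ''S''} m m' \<and>
    (\<forall>a. m' ''S'' a \<noteq> 0 \<longleftrightarrow> m ''S'' a \<noteq> 0 \<or>
      (\<exists>t\<in>{1..H}. m ''X'' (m ''k'' 0) \<le> t \<and> a = m ''I'' (m ''k'' 0) * (H + 1) + t))) m"
proof -
  define k where "k = m ''k'' 0"
  define Inv where "Inv t0 m' \<longleftrightarrow> same {''t'', ''S''} m m' \<and>
    (\<forall>a. m' ''S'' a \<noteq> 0 \<longleftrightarrow> m ''S'' a \<noteq> 0 \<or>
      (\<exists>t\<in>{t0<..H}. m ''X'' k \<le> t \<and> a = m ''I'' k * (H + 1) + t))" for t0 m'
  have "halts mark ((2 + 4) * M ^ Suc 0) (Inv 0) m"
    unfolding mark_def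
  proof (rule halts_for_loop)
    fix t m1 assume t: "0 < t" "t \<le> H" "m1 ''t'' 0 = t" "Inv t m1"
    have [simp]: "m1 ''k'' 0 = k" "m1 ''T'' 0 = H" "m1 ''X'' = m ''X''" "m1 ''I'' = m ''I''"
      using t(4) assms(1) by (auto simp: Inv_def same_def k_def)
    have "{t - 1<..H} = insert t {t<..H}" using t by auto
    then have step: "(\<exists>t'\<in>{t - 1<..H}. P t') \<longleftrightarrow> P t \<or> (\<exists>t'\<in>{t<..H}. P t')" for P by simp
    have "halts (If (Bin Sub (Bin Add (var ''t'') (Const 1)) (Read ''X'' (var ''k'')))
        (Write ''S'' (stacked_entry (var ''t'')) (Const 1)) Skip) (Suc 1)
        (\<lambda>m'. m' ''t'' 0 = t \<and> Inv (t - 1) (m'(''t'' := (m' ''t'')(0 := t - 1)))) m1"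
    proof (rule halts_If, goal_cases)
      case 1
      then have "m ''X'' k \<le> t" using t by simp
      then show ?case using t unfolding Inv_def step
        by (intro halts_Write) (auto simp: stacked_entry_def)
    next
      case 2
      then have "\<not> m ''X'' k \<le> t" using t by simp
      then show ?case using t unfolding Inv_def step by (intro halts_Skip) auto
    qed
    then show "halts (If (Bin Sub (Bin Add (var ''t'') (Const 1)) (Read ''X'' (var ''k'')))
        (Write ''S'' (stacked_entry (var ''t'')) (Const 1)) Skip) (2 * M ^ 0)
        (\<lambda>m'. m' ''t'' 0 = t \<and> Inv (t - 1) (m'(''t'' := (m' ''t'')(0 := t - 1)))) m1"
      by (rule halts_weaken) simp
  next
    show "Inv H (m(''t'' := (m ''t'')(0 := H)))" by (simp add: Inv_def)
  qed (use assms in simp_all)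
  then show ?thesis
    by (rule halts_mono) (auto simp: Inv_def k_def Suc_le_eq)
qed

lemma entry_inject:
  assumes "s \<in> periods I" "t \<in> periods I"
  shows "entry I i s = entry I j t \<longleftrightarrow> i = j \<and> s = t"
proof
  assume eq: "entry I i s = entry I j t"
  have "s < horizon I + 1" "t < horizon I + 1" using assms by (auto simp: periods_def)
  moreover have "entry I i s div (horizon I + 1) = entry I j t div (horizon I + 1)"
    "entry I i s mod (horizon I + 1) = entry I j t mod (horizon I + 1)" by (simp_all only: eq)
  ultimately show "i = j \<and> s = t"
    unfolding entry_def by (simp only: div_mult_self3 mod_mult_self3 div_less mod_less) simp
qed auto

lemma select:
  assumes st: "stack_at I q m" and L: "m ''L'' 0 = L" and M: "L \<le> M" "horizon I \<le> M" "1 \<le> M"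
  shows "halts select (13 * M ^ 2) (\<lambda>m'. \<exists>R lo.
    gik_stack.pass I L (m ''I'') (m ''E'') 0 R lo \<and>
    (\<forall>t\<in>periods I. output_chain I m' t = {i\<in>items I. \<exists>k\<in>R. m ''I'' k = i \<and> m ''X'' k \<le> t})) m"
proof -
  interpret gik_stack I q L "m ''I''" "m ''X''" "m ''E''" "m ''V''"
    using st L by (simp add: stack_at_def)
  have inp: "input_at I m" and S0: "m ''S'' = (\<lambda>_. 0)" using st by (simp_all add: stack_at_def)
  have hor: "horizon I \<in> periods I" using inst by (simp add: gik_instance_def periods_def)
  \<comment> \<open>Couples the output array with the selection. At the last period it becomes the
    test for used items, as no stacked period exceeds the horizon.\<close>
  define marked where "marked R m' \<longleftrightarrow> (\<forall>i\<in>items I. \<forall>t\<in>periods I.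
      m' ''S'' (entry I i t) \<noteq> 0 \<longleftrightarrow> (\<exists>k\<in>R. m ''I'' k = i \<and> m ''X'' k \<le> t))" for R and m' :: memory
  define Inv where "Inv k0 m' \<longleftrightarrow> same {''lo'', ''k'', ''t'', ''S''} m m' \<and>
      (\<exists>R. pass k0 R (m' ''lo'' 0) \<and> marked R m')" for k0 m'
  let ?take = "Seq (assign ''lo'' (Bin Sub (Read ''E'' (var ''k'')) (Read ''w'' (Read ''I'' (var ''k''))))) mark"
  let ?body = "If (Bin Mul
             (Bin Mul (Read ''I'' (var ''k''))
               (Bin Sub (Bin Add (var ''lo'') (Const 1)) (Read ''E'' (var ''k''))))
             (Bin Sub (Const 1) (Read ''S'' (stacked_entry (var ''T''))))) ?take Skip"
  have "halts select (Suc ((8 + 4) * M ^ Suc 1)) (Inv 0) m"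
    unfolding select_def
  proof (rule halts_Write_Seq, rule halts_for_loop)
    fix k m1 assume k: "0 < k" "k \<le> L" "m1 ''k'' 0 = k" "Inv k m1"
    then obtain R where s: "same {''lo'', ''k'', ''t'', ''S''} m m1"
      and R: "pass k R (m1 ''lo'' 0)" "marked R m1" by (auto simp: Inv_def)
    have [simp]: "m1 ''E'' = m ''E''" "m1 ''I'' = m ''I''" "m1 ''X'' = m ''X''" "m1 ''w'' = m ''w''"
      "m1 ''T'' 0 = horizon I"
      using s input_atD(2)[OF inp] by (auto simp: same_def)
    have sel: "R \<subseteq> {2..L}" using R by (simp add: pass_def selection_def)
    have used: "m1 ''S'' (entry I (m ''I'' k) (horizon I)) \<noteq> 0 \<longleftrightarrow> m ''I'' k \<in> m ''I'' ` R"
      if "2 \<le> k"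
    proof -
      have "m ''X'' l \<le> horizon I" if "l \<in> R" for l
        using that sel Pt_periods[of l] by (auto simp: periods_def)
      moreover have "m ''I'' k \<in> items I" using that k by (intro It_items) auto
      moreover from this hor R(2) have "m1 ''S'' (entry I (m ''I'' k) (horizon I)) \<noteq> 0 \<longleftrightarrow>
          (\<exists>l\<in>R. m ''I'' l = m ''I'' k \<and> m ''X'' l \<le> horizon I)"
        by (simp add: marked_def)
      moreover have "m ''I'' k \<in> m ''I'' ` R \<longleftrightarrow> (\<exists>l\<in>R. m ''I'' l = m ''I'' k)"
        unfolding image_iff by (simp only: eq_commute[of "m ''I'' k"])
      ultimately show ?thesis by (simp cong: bex_cong)
    qed
    have "halts ?body (Suc (Suc (6 * M)))
        (\<lambda>m'. m' ''k'' 0 = k \<and> Inv (k - 1) (m'(''k'' := (m' ''k'')(0 := k - 1)))) m1"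
    proof (rule halts_If, goal_cases)
      case 1
      then have test: "m ''I'' k \<noteq> 0" "m ''E'' k \<le> m1 ''lo'' 0"
        "m1 ''S'' (entry I (m ''I'' k) (horizon I)) = 0"
        using k by (auto simp: stacked_entry_def entry_def)
      have "k \<noteq> 1" using test(1) bottom(1) by metis
      then have k2: "k \<in> {2..L}" using k by auto
      then have new: "m ''I'' k \<notin> m ''I'' ` R" using used test(3) by simp
      have item: "m ''I'' k \<in> items I" using It_items k2 .
      let ?lo = "m ''E'' k - weight I (m ''I'' k)"
      have pass: "pass (k - 1) (insert k R) ?lo"
        using R(1) k2 test(2) new by (rule pass_take)
      let ?m = "m1(''lo'' := (m1 ''lo'')(0 := ?lo))"
      have "halts mark (6 * M) (\<lambda>m'. same {''t'', ''S''} ?m m' \<and>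
          (\<forall>a. m' ''S'' a \<noteq> 0 \<longleftrightarrow> ?m ''S'' a \<noteq> 0 \<or>
            (\<exists>t\<in>{1..horizon I}. ?m ''X'' (?m ''k'' 0) \<le> t \<and>
              a = ?m ''I'' (?m ''k'' 0) * (horizon I + 1) + t))) ?m"
        using M by (intro mark) simp_all
      then have "halts mark (6 * M)
          (\<lambda>m'. m' ''k'' 0 = k \<and> Inv (k - 1) (m'(''k'' := (m' ''k'')(0 := k - 1)))) ?m"
      proof (rule halts_mono[OF _ order.refl])
        fix m2 assume m2: "same {''t'', ''S''} ?m m2 \<and>
          (\<forall>a. m2 ''S'' a \<noteq> 0 \<longleftrightarrow> ?m ''S'' a \<noteq> 0 \<or>
            (\<exists>t\<in>{1..horizon I}. ?m ''X'' (?m ''k'' 0) \<le> t \<and>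
              a = ?m ''I'' (?m ''k'' 0) * (horizon I + 1) + t))"
        then have S2: "m2 ''S'' a \<noteq> 0 \<longleftrightarrow> m1 ''S'' a \<noteq> 0 \<or>
            (\<exists>t\<in>periods I. m ''X'' k \<le> t \<and> a = entry I (m ''I'' k) t)" for a
          using k(3) by (simp add: periods_def entry_def)
        have "marked (insert k R) m2" unfolding marked_def
        proof (intro ballI)
          fix i t assume it: "i \<in> items I" "t \<in> periods I"
          have "m2 ''S'' (entry I i t) \<noteq> 0 \<longleftrightarrow>
              m1 ''S'' (entry I i t) \<noteq> 0 \<or> m ''I'' k = i \<and> m ''X'' k \<le> t"
            unfolding S2 by (auto simp: entry_inject[OF it(2)] it(2))
          also have "\<dots> \<longleftrightarrow> (\<exists>k\<in>insert k R. m ''I'' k = i \<and> m ''X'' k \<le> t)"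
            using R(2) it unfolding marked_def by auto
          finally show "m2 ''S'' (entry I i t) \<noteq> 0 \<longleftrightarrow>
              (\<exists>k\<in>insert k R. m ''I'' k = i \<and> m ''X'' k \<le> t)" .
        qed
        then have "marked (insert k R) (m2(''k'' := (m2 ''k'')(0 := k - 1)))"
          by (simp add: marked_def)
        moreover have "m2 ''lo'' 0 = ?lo" "m2 ''k'' 0 = k"
          using m2 k(3) by (simp_all add: same_def)
        moreover have "same {''lo'', ''k'', ''t'', ''S''} m m2"
          using s m2 by (auto simp: same_def)
        ultimately show "m2 ''k'' 0 = k \<and> Inv (k - 1) (m2(''k'' := (m2 ''k'')(0 := k - 1)))"
          using pass by (auto simp: Inv_def)
      qed
      then have "halts ?take (Suc (6 * M))
          (\<lambda>m'. m' ''k'' 0 = k \<and> Inv (k - 1) (m'(''k'' := (m' ''k'')(0 := k - 1)))) m1"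
        by (intro halts_Write_Seq) (simp add: k(3) input_atD(3)[OF inp item])
      then show ?case .
    next
      case 2
      then have "m ''I'' k = 0 \<or> m1 ''lo'' 0 < m ''E'' k \<or>
          m1 ''S'' (entry I (m ''I'' k) (horizon I)) \<noteq> 0"
        using k by (auto simp: stacked_entry_def entry_def)
      \<comment> \<open>Item numbers start at 1, so only the dummy carries item 0.\<close>
      moreover have "k = 1" if "m ''I'' k = 0"
        using It_items[of k] k that by (cases "k = 1") (auto simp: items_def)
      ultimately have "k = 1 \<or> m1 ''lo'' 0 < m ''E'' k \<or> m ''I'' k \<in> m ''I'' ` R"
        using used k by (cases "k = 1") auto
      then have "pass (k - 1) R (m1 ''lo'' 0)" by (rule pass_skip[OF R(1) k(1,2)])
      moreover have "marked R (m1(''k'' := (m1 ''k'')(0 := k - 1)))"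
        using R(2) by (simp add: marked_def)
      moreover have "same {''lo'', ''k'', ''t'', ''S''} m (m1(''k'' := (m1 ''k'')(0 := k - 1)))"
        using s by simp
      ultimately have "Inv (k - 1) (m1(''k'' := (m1 ''k'')(0 := k - 1)))"
        unfolding Inv_def by (intro conjI exI[of _ R]) simp_all
      with k(3) show ?case by (intro halts_Skip) simp_all
    qed
    then show "halts ?body (8 * M ^ 1)
        (\<lambda>m'. m' ''k'' 0 = k \<and> Inv (k - 1) (m'(''k'' := (m' ''k'')(0 := k - 1)))) m1"
      by (rule halts_weaken) (use M in simp)
  next
    let ?m = "m(''lo'' := (m ''lo'')(val (Const 0) m := val (Read ''E'' (var ''L'')) m))"
    have "marked {} (?m(''k'' := (?m ''k'')(0 := L)))" using S0 by (simp add: marked_def)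
    then show "Inv L (?m(''k'' := (?m ''k'')(0 := L)))"
      using pass_init L by (auto simp: Inv_def)
  qed (use L M in simp_all)
  then show ?thesis
  proof (rule halts_mono)
    have "Suc ((8 + 4) * x) \<le> 13 * x" if "1 \<le> x" for x :: nat
      using that by simp
    from this[of "M ^ 2"] show "Suc ((8 + 4) * M ^ Suc 1) \<le> 13 * M ^ 2"
      using M by (simp add: numeral_2_eq_2)
  next
    fix m' assume "Inv 0 m'"
    then obtain R where "pass 0 R (m' ''lo'' 0)" "marked R m'" by (auto simp: Inv_def)
    then show "\<exists>R lo. pass 0 R lo \<and>
        (\<forall>t\<in>periods I. output_chain I m' t = {i\<in>items I. \<exists>k\<in>R. m ''I'' k = i \<and> m ''X'' k \<le> t})"
      by (intro exI[of _ R] exI[of _ "m' ''lo'' 0"]) (auto simp: output_chain_def marked_def)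
  qed
qed

text \<open>Joins the two halves of the local ratio argument: the total value on a saturated stack
  bounds the optimum from above and the profit of the greedy selection from below.\<close>

lemma main:
  assumes inst: "gik_instance I" and q: "1 \<le> q" and M: "M = 1 + n_items I * horizon I * q"
  shows "halts main (52 * M ^ 5)
    (\<lambda>m'. feasible_chain I (output_chain I m') \<and>
      (q - 1) * max_profit I \<le> q * (min 2 (n_items I) * chain_profit I (output_chain I m')))
    ((input_memory I)(''q'' := (input_memory I ''q'')(0 := q)))"
    (is "halts _ _ ?Q ?m")
proof -
  have "n_items I \<noteq> 0" "horizon I \<noteq> 0" using inst by (auto simp: gik_instance_def)
  then have le: "horizon I \<le> M" "1 \<le> M" using q M by (auto simp: Suc_le_eq intro!: le_SucI)
  define m1 where "m1 = ?m(''L'' := (?m ''L'')(0 := 1))"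
  define m2 where "m2 = m1(''go'' := (m1 ''go'')(0 := 1))"
  have "input_at I m2" by (simp add: input_at_def m1_def m2_def)
  moreover have "gik_stack I q 1 (\<lambda>_. 0) (\<lambda>_. 0) (\<lambda>_. 0) (\<lambda>_. 0)"
    using inst by (rule gik_stack_init)
  moreover have "m2 ''L'' 0 = 1" "m2 ''q'' 0 = q" "m2 ''I'' = (\<lambda>_. 0)" "m2 ''X'' = (\<lambda>_. 0)"
    "m2 ''E'' = (\<lambda>_. 0)" "m2 ''V'' = (\<lambda>_. 0)" "m2 ''S'' = (\<lambda>_. 0)"
    by (simp_all add: m1_def m2_def input_memory_def)
  ultimately have "stack_at I q m2" by (simp add: stack_at_def)
  moreover have "m2 ''go'' 0 \<noteq> 0" by (simp add: m2_def)
  ultimately have built: "halts build (36 * M ^ 5) (\<lambda>m'. stack_at I q m' \<and> saturated I m') m2"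
    using q M by (rule build)
  have "halts select (13 * M ^ 2) ?Q m" if st: "stack_at I q m" and sat: "saturated I m" for m
  proof -
    define L where "L = m ''L'' 0"
    interpret gik_stack I q L "m ''I''" "m ''X''" "m ''E''" "m ''V''"
      using st by (simp add: stack_at_def L_def)
    have "L \<le> M" using L_bound M by simp
    then have "halts select (13 * M ^ 2) (\<lambda>m'. \<exists>R lo. pass 0 R lo \<and>
        (\<forall>t\<in>periods I. output_chain I m' t = {i\<in>items I. \<exists>k\<in>R. m ''I'' k = i \<and> m ''X'' k \<le> t})) m"
      using le by (intro select[OF st]) (simp_all add: L_def)
    then show ?thesis
    proof (rule halts_mono[OF _ order.refl])
      fix m' assume "\<exists>R lo. pass 0 R lo \<and>
        (\<forall>t\<in>periods I. output_chain I m' t = {i\<in>items I. \<exists>k\<in>R. m ''I'' k = i \<and> m ''X'' k \<le> t})"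
      then obtain R lo where pass: "pass 0 R lo"
        and out: "\<And>t. t \<in> periods I \<Longrightarrow>
          output_chain I m' t = {i\<in>items I. \<exists>k\<in>R. m ''I'' k = i \<and> m ''X'' k \<le> t}" by blast
      have chain: "output_chain I m' = selected_chain R"
      proof
        fix t
        show "output_chain I m' t = selected_chain R t"
          using out[of t] by (cases "t \<in> periods I") (simp_all add: selected_chain_def output_chain_def)
      qed
      have R: "selection R" using pass by (simp add: pass_def)
      have maximal: "\<exists>k'\<in>R. k < k' \<and> (m ''I'' k = m ''I'' k' \<or> m ''E'' k' < m ''E'' k + weight I (m ''I'' k'))"
        if "k \<in> {2..L} - R" for k
        using pass that unfolding pass_def by auto
      have none: "\<not> ok i t (max (m ''E'' L) (m ''E'' k + weight I i))"
        if "i \<in> items I" "t \<in> periods I" "k \<in> {1..L}" for i t k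
      proof -
        have "\<not> mem_ok m i t (mem_end m i k)" using sat that by (simp add: saturated_def L_def)
        then show ?thesis unfolding mem_ok_eq[OF st that(1,2)] mem_end_eq[OF st that(1)] L_def .
      qed
      have "(q - 1) * max_profit I \<le> q * (min 2 (n_items I) * sum (m ''V'') {2..L})"
        using none by (rule max_profit_le)
      also have "\<dots> \<le> q * (min 2 (n_items I) * chain_profit I (output_chain I m'))"
        unfolding chain chain_profit_selected[OF R]
        using selection_profit_ge[OF R maximal] by (intro mult_le_mono2)
      finally show "?Q m'" using feasible_selected_chain[OF R] chain by simp
    qed
  qed
  then have "halts (Seq build select) (36 * M ^ 5 + 13 * M ^ 2) ?Q m2"
    by (intro halts_Seq halts_mono[OF built order.refl]) auto
  then have "halts main (Suc (Suc (36 * M ^ 5 + 13 * M ^ 2))) ?Q ?m"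
    unfolding main_def by (intro halts_Write_Seq) (simp add: m1_def m2_def)
  then show ?thesis
  proof (rule halts_weaken)
    have "M ^ 2 \<le> M ^ 5" "1 \<le> M ^ 5" using le by (simp_all add: power_increasing)
    moreover have "Suc (Suc (36 * x + 13 * y)) \<le> 52 * x" if "y \<le> x" "1 \<le> x" for x y :: nat
      using that by linarith
    ultimately show "Suc (Suc (36 * M ^ 5 + 13 * M ^ 2)) \<le> 52 * M ^ 5" by blast
  qed
qed

section \<open>Input size, total running time and choice of the threshold\<close>

lemma bits_mono: "j \<le> k \<Longrightarrow> bits j \<le> bits k"
  unfolding bits_def by (intro max.mono order.refl floorlog_mono)

lemma one_le_bits: "1 \<le> bits k"
  by (simp add: bits_def)

text \<open>Because \<open>bits\<close> is at least 1, the input size dominates the numbers of items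
  and periods as well as the length of each datum; hence it also bounds the cells that hold these
  two numbers.\<close>

lemma input_size_ge:
  assumes "gik_instance I"
  shows "n_items I * horizon I \<le> input_size I" "1 \<le> input_size I"
    and "bounded (input_size I) (input_memory I)"
proof -
  have pos: "1 \<le> n_items I" "1 \<le> horizon I" using assms by (auto simp: gik_instance_def)
  let ?w = "Max (weight I ` items I)" and ?W = "Max (capacity I ` periods I)"
    and ?p = "Max ((\<lambda>(i, t). profit I i t) ` (items I \<times> periods I))"
  let ?S = "input_size I"
  have mult_ge: "x \<le> x * bits k" for x k :: nat using mult_le_mono2[OF one_le_bits, of x k] by simp
  have parts: "n_items I * bits ?w \<le> ?S" "n_items I * horizon I * bits ?p \<le> ?S"
    "horizon I * bits ?W \<le> ?S" by (simp_all add: input_size_def)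
  show nT: "n_items I * horizon I \<le> ?S" using mult_ge parts(2) by (rule order_trans)
  have n: "n_items I \<le> ?S" using mult_ge parts(1) by (rule order_trans)
  have T: "horizon I \<le> ?S" using mult_ge parts(3) by (rule order_trans)
  show "1 \<le> ?S" using pos(1) n by simp
  have bitsS: "bits ?w \<le> ?S" "bits ?p \<le> ?S" "bits ?W \<le> ?S"
  proof -
    have le: "y \<le> x * y" if "1 \<le> x" for x y :: nat using mult_le_mono1[OF that, of y] by simp
    show "bits ?w \<le> ?S" using le[OF pos(1)] parts(1) by (rule order_trans)
    show "bits ?W \<le> ?S" using le[OF pos(2)] parts(3) by (rule order_trans)
    have "1 \<le> n_items I * horizon I" using pos by simp
    from le[OF this] show "bits ?p \<le> ?S" using parts(2) by (rule order_trans)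
  qed
  have small: "k < 2 ^ ?S" if "k \<le> b" "bits b \<le> ?S" for k b
  proof -
    have "k < 2 ^ bits k" by (rule less_two_power_bits)
    also have "\<dots> \<le> 2 ^ ?S" using bits_mono[OF that(1)] that(2) by (intro power_increasing) auto
    finally show ?thesis .
  qed
  have fin: "finite (items I)" "finite (periods I)" by (simp_all add: items_def periods_def)
  have w: "weight I i < 2 ^ ?S" if "i \<in> items I" for i
    using that fin by (intro small[OF _ bitsS(1)] Max_ge) auto
  have W: "capacity I t < 2 ^ ?S" if "t \<in> periods I" for t
    using that fin by (intro small[OF _ bitsS(3)] Max_ge) auto
  have p: "profit I i t < 2 ^ ?S" if "i \<in> items I" "t \<in> periods I" for i t
    using that fin by (intro small[OF _ bitsS(2)] Max_ge) force+
  have lin: "k < 2 ^ ?S" if "k \<le> ?S" for k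
    using that less_exp[of ?S] by (rule order_le_less_trans)
  show "bounded ?S (input_memory I)"
    using w W p lin[OF n] lin[OF T] by (auto simp: bounded_def input_memory_def Let_def)
qed

text \<open>Free of \<open>q\<close> and of the accuracy. The number 1664 is
  \<open>52 * 2 ^ 5\<close>, from \<open>52 * M ^ 5\<close> steps and \<open>M \<le> 2 * X\<close>,
  where \<open>X\<close> is the input size times \<open>q\<close>; the summand 2 accounts for the
  initial cell length \<open>input_size I + q\<close>, and 30 for the choice of \<open>q\<close>
  before \<open>main\<close>.\<close>

definition time_factor :: nat where
  "time_factor = 30 + fee main * 1664 * (2 + growth main * 1664)"

lemma program_run:
  assumes inst: "gik_instance I" and Q: "1 \<le> Q"
    and q: "q = (if n_items I = 1 then 2 else Q)"
  obtains k m where "run (program Q) (input_memory I) k m"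
    "feasible_chain I (output_chain I m)"
    "(q - 1) * max_profit I \<le> q * (min 2 (n_items I) * chain_profit I (output_chain I m))"
    "k \<le> time_factor * (input_size I * q) ^ 10"
proof -
  let ?S = "input_size I"
  define M where "M = 1 + n_items I * horizon I * q"
  define N where "N = 52 * M ^ 5"
  define X where "X = ?S * q"
  have q1: "1 \<le> q" using q Q by simp
  have n1: "1 \<le> n_items I" and T1: "1 \<le> horizon I" using inst by (auto simp: gik_instance_def)
  note size = input_size_ge[OF inst]
  have X: "1 \<le> X" "?S \<le> X" "q \<le> X"
    unfolding X_def using mult_le_mono[OF size(2) q1] mult_le_mono2[OF q1, of ?S]
      mult_le_mono1[OF size(2), of q] by simp_all
  let ?m = "(input_memory I)(''q'' := (input_memory I ''q'')(0 := q))"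
  let ?b = "Bin Sub (var ''n'') (Const 1)"
  obtain N' m where steps: "steps main ?m N' m" "N' \<le> N" and res: "feasible_chain I (output_chain I m)"
    "(q - 1) * max_profit I \<le> q * (min 2 (n_items I) * chain_profit I (output_chain I m))"
    using main[OF inst q1 M_def] unfolding halts_def N_def by blast
  have "bounded (?S + q) ?m"
  proof -
    have "bounded (?S + q) (input_memory I)" using size(3) by (rule bounded_mono) simp
    moreover have "q < 2 ^ q" by (rule less_exp)
    moreover have "(2::nat) ^ q \<le> 2 ^ (?S + q)" by (intro power_increasing) auto
    ultimately have "bounded (?S + q) (input_memory I)" "q < 2 ^ (?S + q)" by linarith+
    then show ?thesis by (auto simp: bounded_def)
  qed
  then obtain k1 where k1: "run main ?m k1 m" "k1 \<le> fee main * N' * (?S + q + growth main * N')"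
    using steps_run[OF steps(1) linear_main, of "?S + q"] q1 by auto
  let ?k0 = "cost ?b (input_memory I) + bits (val ?b (input_memory I)) + (1 + bits q + 1 + bits q)"
  have bits0: "bits 0 = 1" by (simp add: bits_def floorlog_def)
  have "run (If ?b (assign ''q'' (Const Q)) (assign ''q'' (Const 2))) (input_memory I) ?k0 ?m"
  proof (cases "n_items I = 1")
    case True
    have "run (assign ''q'' (Const 2)) (input_memory I) (1 + bits q + 1 + bits q) ?m"
      using run_Write[of "''q''" "Const 0" "Const 2" "input_memory I"] q True bits0 by simp
    moreover have "val ?b (input_memory I) = 0" using True by (simp add: input_memory_def)
    ultimately show ?thesis by (intro run_If_False)
  next
    case False
    have "run (assign ''q'' (Const Q)) (input_memory I) (1 + bits q + 1 + bits q) ?m"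
      using run_Write[of "''q''" "Const 0" "Const Q" "input_memory I"] q False bits0 by simp
    moreover have "val ?b (input_memory I) \<noteq> 0" using False n1 by (simp add: input_memory_def)
    ultimately show ?thesis by (intro run_If_True)
  qed
  then have run: "run (program Q) (input_memory I) (?k0 + k1) m"
    unfolding program_def using k1(1) by (rule run_Seq)
  have k0: "?k0 \<le> 30 * X"
  proof -
    have "cost ?b (input_memory I) \<le> price ?b * ?S" using size(3,2) by (rule cost_le)
    moreover have "bits (val ?b (input_memory I)) \<le> width ?b * ?S" using size(3,2) by (rule bits_val_le)
    moreover have "bits q \<le> q" using q1 by (intro bits_le less_exp)
    ultimately show ?thesis using X by simp
  qed
  have MX: "M \<le> 2 * X"
  proof -
    have "n_items I * horizon I * q \<le> X" unfolding X_def using size(1) by (rule mult_le_mono1)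
    then show ?thesis using X(1) by (simp add: M_def)
  qed
  have N: "N \<le> 1664 * X ^ 5"
    using power_mono[OF MX, of 5] by (simp add: N_def power_mult_distrib)
  have X5: "X \<le> X ^ 5" "X ^ 5 * X ^ 5 = X ^ 10" "1 \<le> X ^ 5"
    using X(1) power_increasing[of 1 5 X] by (simp_all flip: power_add)
  \<comment> \<open>The number of steps and the length of the cells are both of order
    \<open>X ^ 5\<close>, whence the degree 10.\<close>
  have "k1 \<le> fee main * (1664 * X ^ 5) * (2 * X ^ 5 + growth main * (1664 * X ^ 5))"
    using k1(2)
  proof (rule order_trans)
    have "N' \<le> 1664 * X ^ 5" using steps(2) N by simp
    moreover have "?S + q \<le> 2 * X ^ 5" using X X5 by linarith
    ultimately show "fee main * N' * (?S + q + growth main * N') \<le>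
        fee main * (1664 * X ^ 5) * (2 * X ^ 5 + growth main * (1664 * X ^ 5))"
      by (intro mult_le_mono add_mono order.refl)
  qed
  also have "\<dots> = fee main * 1664 * (2 + growth main * 1664) * (X ^ 5 * X ^ 5)"
    by (simp only: distrib_left distrib_right ac_simps)
  finally have "k1 \<le> fee main * 1664 * (2 + growth main * 1664) * X ^ 10" by (simp only: X5(2))
  moreover have "?k0 \<le> 30 * X ^ 10"
  proof -
    have "X \<le> X ^ 10" using X(1) power_increasing[of 1 10 X] by simp
    then show ?thesis using k0 by linarith
  qed
  ultimately have "?k0 + k1 \<le> time_factor * X ^ 10"
    unfolding time_factor_def distrib_right by (rule add_mono[rotated])
  then show thesis using run res by (intro that) (simp_all add: X_def)
qed

theorem theorem3:
  "\<exists>(K :: real) (C :: real) (d :: nat). \<forall>\<epsilon> :: real. 0 < \<epsilon> \<and> \<epsilon> < 1 / 2 \<longrightarrow>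
     (\<exists>prog :: com. \<forall>I :: gik. gik_instance I \<longrightarrow>
       (\<exists>(k :: nat) (m :: memory).
          run prog (input_memory I) k m \<and>
          feasible_chain I (output_chain I m) \<and>
          real (chain_profit I (output_chain I m)) \<ge> (1 / 2 - \<epsilon>) * real (max_profit I) \<and>
          real k \<le> K * real (n_items I) powr (C / \<epsilon>\<^sup>2) * real (input_size I) ^ d))"
\<comment> \<open>The factor \<open>2 ^ 10\<close> pays for \<open>q = 2\<close> in the case of a
  single item; with more items, the power \<open>10 / \<epsilon>\<^sup>2\<close> of their number
  absorbs \<open>Q ^ 10\<close>.\<close>
proof (rule exI[of _ "real time_factor * 2 ^ 10"], rule exI[of _ 10], rule exI[of _ 10], intro allI impI)
  fix \<epsilon> :: real assume \<epsilon>: "0 < \<epsilon> \<and> \<epsilon> < 1 / 2"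
  \<comment> \<open>With \<open>Q \<ge> 1 / (2 * \<epsilon>)\<close> the ratio
    \<open>(1 - 1 / Q) / 2\<close> is at least \<open>1 / 2 - \<epsilon>\<close>.\<close>
  define Q where "Q = nat \<lceil>1 / (2 * \<epsilon>)\<rceil>"
  have Q_ge: "1 / (2 * \<epsilon>) \<le> real Q" unfolding Q_def by linarith
  have one: "1 \<le> 1 / (2 * \<epsilon>)" using \<epsilon> by simp
  have Q1: "1 \<le> Q" using Q_ge one by linarith
  have "real Q \<le> 1 / (2 * \<epsilon>) + 1" unfolding Q_def using one by linarith
  also have "\<dots> \<le> 1 / (2 * \<epsilon>) + 1 / (2 * \<epsilon>)" using one by linarith
  also have "\<dots> = 1 / \<epsilon>" by simp
  also have "\<dots> \<le> 1 / \<epsilon>\<^sup>2"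
    using \<epsilon> by (simp add: power2_eq_square field_simps)
  finally have Q_le: "real Q \<le> 1 / \<epsilon>\<^sup>2" .
  show "\<exists>prog. \<forall>I. gik_instance I \<longrightarrow>
       (\<exists>k m.
          run prog (input_memory I) k m \<and>
          feasible_chain I (output_chain I m) \<and>
          real (chain_profit I (output_chain I m)) \<ge> (1 / 2 - \<epsilon>) * real (max_profit I) \<and>
          real k \<le> real time_factor * 2 ^ 10 * real (n_items I) powr (10 / \<epsilon>\<^sup>2) * real (input_size I) ^ 10)"
  proof (intro exI[of _ "program Q"] allI impI)
    fix I assume inst: "gik_instance I"
    let ?n = "n_items I"
    define q where "q = (if ?n = 1 then 2 else Q)"
    obtain k m where run: "run (program Q) (input_memory I) k m"
      and feas: "feasible_chain I (output_chain I m)"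
      and approx: "(q - 1) * max_profit I \<le> q * (min 2 ?n * chain_profit I (output_chain I m))"
      and time: "k \<le> time_factor * (input_size I * q) ^ 10"
      using program_run[OF inst Q1 q_def] by metis
    have n1: "1 \<le> ?n" using inst by (simp add: gik_instance_def)
    let ?P = "real (chain_profit I (output_chain I m))" and ?O = "real (max_profit I)"
    have "(1 / 2 - \<epsilon>) * ?O \<le> ?P"
    proof (cases "?n = 1")
      case True
      \<comment> \<open>For a single item the conflict factor is 1, so the whole loss is the factor
        2 caused by the threshold \<open>q = 2\<close>.\<close>
      then have "max_profit I \<le> 2 * chain_profit I (output_chain I m)"
        using approx by (simp add: q_def)
      then have "?O \<le> 2 * ?P" by linarith
      moreover have "0 \<le> \<epsilon> * ?O" using \<epsilon> by simp
      ultimately show ?thesis by (simp add: left_diff_distrib)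
    next
      case False
      then have "(Q - 1) * max_profit I \<le> Q * (2 * chain_profit I (output_chain I m))"
        using approx n1 by (simp add: q_def)
      then have "real ((Q - 1) * max_profit I) \<le> real (Q * (2 * chain_profit I (output_chain I m)))"
        by (simp only: of_nat_le_iff)
      then have *: "(real Q - 1) * ?O \<le> real Q * (2 * ?P)" using Q1 by (simp add: of_nat_diff)
      have "1 \<le> 2 * \<epsilon> * real Q" using Q_ge \<epsilon> by (simp add: field_simps)
      then have "1 * ?O \<le> 2 * \<epsilon> * real Q * ?O" by (intro mult_right_mono) auto
      with * have "real Q * (2 * ((1 / 2 - \<epsilon>) * ?O)) \<le> real Q * (2 * ?P)"
        by (simp add: algebra_simps)
      then show ?thesis using Q1 by simp
    qed
    moreover have "real k \<le> real time_factor * 2 ^ 10 * real ?n powr (10 / \<epsilon>\<^sup>2) * real (input_size I) ^ 10"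
    proof -
      have q10: "real q ^ 10 \<le> 2 ^ 10 * real ?n powr (10 / \<epsilon>\<^sup>2)"
      proof (cases "?n = 1")
        case True
        then show ?thesis by (simp add: q_def)
      next
        case False
        then have n2: "2 \<le> real ?n" using n1 by linarith
        \<comment> \<open>A crude exponential bound suffices: with at least two items, 2 may be
          replaced by their number, and \<open>Q\<close> is at most
          \<open>1 / \<epsilon>\<^sup>2\<close>.\<close>
        have "real Q \<le> 2 ^ Q" using less_exp[of Q] by (metis less_imp_le of_nat_le_iff of_nat_numeral of_nat_power)
        also have "\<dots> = 2 powr real Q" by (simp add: powr_realpow)
        also have "\<dots> \<le> 2 powr (1 / \<epsilon>\<^sup>2)" using Q_le by simp
        also have "\<dots> \<le> real ?n powr (1 / \<epsilon>\<^sup>2)" using n2 by (intro powr_mono2) auto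
        finally have "real Q ^ 10 \<le> (real ?n powr (1 / \<epsilon>\<^sup>2)) ^ 10" by (intro power_mono) auto
        also have "\<dots> = real ?n powr (10 / \<epsilon>\<^sup>2)"
          using n2 by (simp add: powr_powr flip: powr_realpow)
        also have "\<dots> \<le> 2 ^ 10 * real ?n powr (10 / \<epsilon>\<^sup>2)" by simp
        finally show ?thesis using False by (simp add: q_def)
      qed
      have "real k \<le> real (time_factor * (input_size I * q) ^ 10)" using time by (simp only: of_nat_le_iff)
      also have "\<dots> = real time_factor * real q ^ 10 * real (input_size I) ^ 10"
        by (simp add: power_mult_distrib)
      also have "\<dots> \<le> real time_factor * (2 ^ 10 * real ?n powr (10 / \<epsilon>\<^sup>2)) * real (input_size I) ^ 10"
        using q10 by (intro mult_right_mono mult_left_mono) auto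
      finally show ?thesis by (simp only: mult.assoc)
    qed
    ultimately show "\<exists>k m. run (program Q) (input_memory I) k m \<and>
        feasible_chain I (output_chain I m) \<and>
        (1 / 2 - \<epsilon>) * ?O \<le> real (chain_profit I (output_chain I m)) \<and>
        real k \<le> real time_factor * 2 ^ 10 * real ?n powr (10 / \<epsilon>\<^sup>2) * real (input_size I) ^ 10"
      using run feas by blast
  qed
qed

end
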